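(* Let $G$ be a finite group of complex $n\times n$ unitary matrices generated by reflections acting on $V=\mathbb{C}^n$, and let $\chi$ be a multiplicative character of $G$. The $R$-module $\Omega^\chi$ of $\chi$-invariant differential forms is closed under $\chi$-wedging: if $\mu,\omega\in\Omega^\chi$, then $\mu\curlywedge\omega=(\mu\wedge\omega)/Q_\chi\in\Omega^\chi$.
   Context: A reflection is a non-identity unitary matrix of finite order fixing a hyperplane of $V=\mathbb{C}^n$ pointwise. $S=\mathbb{C}[x_1,\ldots,x_n]$ is the ring of polynomials on $V$. $G$ acts contragrediently: $(gf)(v)=f(g^{-1}v)$ for $f\in S$. $R=S^G$ is the ring of invariant polynomials. A multiplicative character is a homomorphism $\chi:G\to\mathbb{C}^*$; $\det$ denotes the determinant character of $G$ on $V$. Differential $p$-forms: $\Omega^p=\bigoplus_{1\le i_1<\cdots<i_p\le n}S\,dx_{i_1}\wedge\cdots\wedge dx_{i_p}\simeq S\otimes\bigwedge^pV^*$, with the induced $G$-action ($g\,dx_i=d(gx_i)$). $(\Omega^p)^\chi=\{\omega\in\Omega^p: g\omega=\chi(g)\omega\ \text{for all } g\in G\}$, and $\Omega^\chi=\bigoplus_{p\ge0}(\Omega^p)^\chi$. Let $\mathcal{A}$ be the set of reflecting hyperplanes of $G$; for $H\in\mathcal{A}$ let $\alpha_H\in S$ be a linear form with kernel $H$, $G_H$ the cyclic subgroup of elements of $G$ fixing $H$ pointwise, $s_H$ a generator of $G_H$, of order $o(s_H)$, and $a_H(\chi)$ the least integer with $0\le a_H(\chi)<o(s_H)$ and $\chi(s_H)=\det(s_H)^{-a_H(\chi)}$.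 Put $Q_\chi=\prod_{H\in\mathcal{A}}\alpha_H^{a_H(\chi)}$ (well defined up to a nonzero scalar; fix a choice). The $\chi$-wedge of differential forms $\mu,\omega$ is $\mu\curlywedge\omega:=(\mu\wedge\omega)/Q_\chi$. *)

theory Defs
  imports
    "HOL-Analysis.Analysis"
    "HOL-Library.Poly_Mapping"
    "HOL-Algebra.Multiplicative_Group"
    "HOL-Algebra.Generated_Groups"
begin

text \<open>
  The coordinates of \<open>V\<close>, the type \<open>'n cvec\<close>, are indexed by a finite linearly ordered type
  \<open>'n\<close>; the order is only used to fix the signs in the exterior algebra.
\<close>

type_synonym 'n cvec = "(complex, 'n) vec"
type_synonym 'n cmat = "((complex, 'n) vec, 'n) vec"

subsection \<open>The unitary group, hyperplanes and reflections\<close>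

definition conj_transpose :: "'n::finite cmat \<Rightarrow> 'n cmat" where
  "conj_transpose A = (\<chi> i j. cnj (A $ j $ i))"

definition unitary_matrix :: "'n::finite cmat \<Rightarrow> bool" where
  "unitary_matrix A \<longleftrightarrow> conj_transpose A ** A = mat 1 \<and> A ** conj_transpose A = mat 1"

definition unitary_group :: "'n::finite cmat monoid" where
  "unitary_group = \<lparr>carrier = {A. unitary_matrix A}, monoid.mult = (**), one = mat 1\<rparr>"

text \<open>\<open>vec.subspace\<close> and \<open>vec.dim\<close> are taken over the scalar field \<open>complex\<close>.\<close>

definition hyperplane :: "'n::finite cvec set \<Rightarrow> bool" where
  "hyperplane H \<longleftrightarrow> vec.subspace H \<and> vec.dim H = CARD('n) - 1"

definition reflection :: "'n::finite cmat \<Rightarrow> bool" where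
  "reflection g \<longleftrightarrow>
     unitary_matrix g \<and> g \<noteq> mat 1 \<and>
     (\<exists>k>0. g [^]\<^bsub>unitary_group\<^esub> (k::nat) = mat 1) \<and>
     (\<exists>H. hyperplane H \<and> (\<forall>v\<in>H. g *v v = v))"

definition reflecting_hyperplanes :: "'n::finite cmat set \<Rightarrow> 'n cvec set set" where
  "reflecting_hyperplanes G =
     {H. hyperplane H \<and> (\<exists>g\<in>G. reflection g \<and> (\<forall>v\<in>H. g *v v = v))}"

definition pointwise_stabilizer ::
    "'n::finite cmat set \<Rightarrow> 'n cvec set \<Rightarrow> 'n cmat set" where
  "pointwise_stabilizer G H = {g \<in> G. \<forall>v\<in>H. g *v v = v}"

text \<open>Characters are written \<open>\<psi>\<close>, since \<open>\<chi>\<close> is the binder for vectors.\<close>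

definition complex_units :: "complex monoid" where
  "complex_units = \<lparr>carrier = UNIV - {0}, monoid.mult = (*), one = 1\<rparr>"

definition mult_character :: "'n::finite cmat set \<Rightarrow> ('n cmat \<Rightarrow> complex) \<Rightarrow> bool" where
  "mult_character G \<psi> \<longleftrightarrow> \<psi> \<in> hom (unitary_group\<lparr>carrier := G\<rparr>) complex_units"

subsection \<open>The polynomial ring and the contragredient action\<close>

text \<open>A polynomial maps exponent vectors to coefficients; \<open>*\<close> is convolution.\<close>

type_synonym 'n pol = "('n \<Rightarrow>\<^sub>0 nat) \<Rightarrow>\<^sub>0 complex"

definition pconst :: "complex \<Rightarrow> 'n pol" where
  "pconst c = Poly_Mapping.single 0 c"

definition pvar :: "'n \<Rightarrow> 'n pol" where
  "pvar i = Poly_Mapping.single (Poly_Mapping.single i 1) 1"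

definition peval :: "'n::finite pol \<Rightarrow> 'n cvec \<Rightarrow> complex" where
  "peval f v = (\<Sum>m\<in>Poly_Mapping.keys f.
     Poly_Mapping.lookup f m * (\<Prod>i\<in>UNIV. (v $ i) ^ Poly_Mapping.lookup m i))"

definition psubst :: "('n::finite \<Rightarrow> 'n pol) \<Rightarrow> 'n pol \<Rightarrow> 'n pol" where
  "psubst \<sigma> f = (\<Sum>m\<in>Poly_Mapping.keys f.
     pconst (Poly_Mapping.lookup f m) * (\<Prod>i\<in>UNIV. \<sigma> i ^ Poly_Mapping.lookup m i))"

text \<open>
  \<open>(gf)(v) = f(g\<^sup>-\<^sup>1v)\<close>, i.e. the \<open>i\<close>-th coordinate of \<open>g\<^sup>-\<^sup>1v\<close> is substituted for
  the \<open>i\<close>-th variable; see \<open>peval_pact\<close> below.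
\<close>

definition pact :: "'n cmat \<Rightarrow> 'n::finite pol \<Rightarrow> 'n pol" where
  "pact g f = psubst (\<lambda>i. \<Sum>j\<in>UNIV. pconst (matrix_inv g $ i $ j) * pvar j) f"

definition invariant_pols :: "'n cmat set \<Rightarrow> 'n::finite pol set" where
  "invariant_pols G = {f. \<forall>g\<in>G. pact g f = f}"

definition linear_form :: "'n::finite pol \<Rightarrow> bool" where
  "linear_form f \<longleftrightarrow> (\<exists>c :: 'n cvec. f = (\<Sum>i\<in>UNIV. pconst (c $ i) * pvar i))"

definition ppartial :: "'n \<Rightarrow> 'n pol \<Rightarrow> 'n pol" where
  "ppartial i f = (\<Sum>m\<in>Poly_Mapping.keys f.
     Poly_Mapping.single (m - Poly_Mapping.single i 1)
       (of_nat (Poly_Mapping.lookup m i) * Poly_Mapping.lookup f m))"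

subsection \<open>Differential forms\<close>

text \<open>
  A form is the family of its coefficients: \<open>\<omega> I\<close> is the coefficient of
  \<open>dx\<^bsub>i\<^sub>1\<^esub> \<and> \<dots> \<and> dx\<^bsub>i\<^sub>p\<^esub>\<close>, where \<open>I = {i\<^sub>1 < \<dots> < i\<^sub>p}\<close>.
\<close>

type_synonym 'n form = "'n set \<Rightarrow> 'n pol"

definition forms_of_degree :: "nat \<Rightarrow> 'n form set" where
  "forms_of_degree p = {\<omega>. \<forall>I. card I \<noteq> p \<longrightarrow> \<omega> I = 0}"

definition fscale :: "'n pol \<Rightarrow> 'n form \<Rightarrow> 'n form" where
  "fscale f \<omega> = (\<lambda>I. f * \<omega> I)"

definition fone :: "'n form" where
  "fone = (\<lambda>I. if I = {} then 1 else 0)"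

text \<open>
  For disjoint \<open>I\<close> and \<open>J\<close>, sorting the indices in \<open>dx\<^sub>I \<and> dx\<^sub>J\<close> introduces one sign for
  each pair \<open>(i, j) \<in> I \<times> J\<close> with \<open>j < i\<close>.
\<close>

definition wedge :: "'n::{finite,linorder} form \<Rightarrow> 'n form \<Rightarrow> 'n form" where
  "wedge \<mu> \<omega> = (\<lambda>K. \<Sum>I\<in>Pow K.
     (- 1) ^ card {(i, j). i \<in> I \<and> j \<in> K - I \<and> j < i} * (\<mu> I * \<omega> (K - I)))"

definition dpol :: "'n::finite pol \<Rightarrow> 'n form" where
  "dpol f = (\<lambda>I. \<Sum>i\<in>UNIV. if I = {i} then ppartial i f else 0)"

definition dx_wedge :: "'n::{finite,linorder} set \<Rightarrow> 'n form" where
  "dx_wedge I = foldr (\<lambda>i. wedge (dpol (pvar i))) (sorted_list_of_set I) fone"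

text \<open>The image of \<open>dx_wedge I\<close> under \<open>g\<close>, with \<open>g dx\<^sub>i = d(gx\<^sub>i)\<close>.\<close>

definition act_dx_wedge :: "'n cmat \<Rightarrow> 'n::{finite,linorder} set \<Rightarrow> 'n form" where
  "act_dx_wedge g I =
     foldr (\<lambda>i. wedge (dpol (pact g (pvar i)))) (sorted_list_of_set I) fone"

definition form_act :: "'n cmat \<Rightarrow> 'n::{finite,linorder} form \<Rightarrow> 'n form" where
  "form_act g \<omega> = (\<lambda>K. \<Sum>I\<in>UNIV. fscale (pact g (\<omega> I)) (act_dx_wedge g I) K)"

definition chi_forms_of_degree ::
    "'n cmat set \<Rightarrow> ('n cmat \<Rightarrow> complex) \<Rightarrow> nat
      \<Rightarrow> 'n::{finite,linorder} form set" where
  "chi_forms_of_degree G \<psi> p =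
     {\<omega> \<in> forms_of_degree p. \<forall>g\<in>G. form_act g \<omega> = fscale (pconst (\<psi> g)) \<omega>}"

definition chi_forms ::
    "'n cmat set \<Rightarrow> ('n cmat \<Rightarrow> complex) \<Rightarrow> 'n::{finite,linorder} form set" where
  "chi_forms G \<psi> =
     {\<omega>. \<exists>\<eta>. (\<forall>p. \<eta> p \<in> chi_forms_of_degree G \<psi> p) \<and> \<omega> = (\<lambda>I. \<Sum>p\<le>CARD('n). \<eta> p I)}"

subsection \<open>The polynomial \<open>Q\<^sub>\<psi>\<close> and \<open>\<psi>\<close>-wedging\<close>

text \<open>The exponent \<open>a\<^sub>H(\<psi>)\<close> in terms of the chosen generator \<open>s\<close> of \<open>G\<^sub>H\<close>.\<close>

definition chi_exponent :: "('n cmat \<Rightarrow> complex) \<Rightarrow> 'n::finite cmat \<Rightarrow> nat" where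
  "chi_exponent \<psi> s =
     (LEAST a. a < group.ord unitary_group s \<and> \<psi> s = det s powi (- int a))"

definition Q_chi ::
    "'n cmat set \<Rightarrow> ('n cmat \<Rightarrow> complex) \<Rightarrow> ('n cvec set \<Rightarrow> 'n pol)
      \<Rightarrow> ('n cvec set \<Rightarrow> 'n cmat) \<Rightarrow> 'n::finite pol" where
  "Q_chi G \<psi> \<alpha> s = (\<Prod>H\<in>reflecting_hyperplanes G. \<alpha> H ^ chi_exponent \<psi> (s H))"

text \<open>
  \<open>(\<mu> \<and> \<omega>) / Q\<close>, to be used only if \<open>Q\<close> divides \<open>\<mu> \<and> \<omega>\<close>; see \<open>chi_wedge_eq\<close> below.
\<close>

definition chi_wedge :: "'n pol \<Rightarrow> 'n::{finite,linorder} form \<Rightarrow> 'n form \<Rightarrow> 'n form" where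
  "chi_wedge Q \<mu> \<omega> = (THE \<eta>. fscale Q \<eta> = wedge \<mu> \<omega>)"

subsection \<open>Basic facts\<close>

lemma conj_transpose_mult: "conj_transpose (A ** B) = conj_transpose B ** conj_transpose A"
  by (simp add: conj_transpose_def matrix_matrix_mult_def vec_eq_iff mult.commute)

lemma conj_transpose_involution: "conj_transpose (conj_transpose A) = A"
  by (simp add: conj_transpose_def vec_eq_iff)

lemma conj_transpose_mat_1: "conj_transpose (mat 1) = mat 1"
  by (simp add: conj_transpose_def mat_def vec_eq_iff)

lemma group_unitary_group: "group (unitary_group :: 'n::finite cmat monoid)"
proof (rule groupI)
  fix A B :: "'n cmat"
  assume "A \<in> carrier unitary_group" "B \<in> carrier unitary_group"
  hence u: "conj_transpose A ** A = mat 1" "A ** conj_transpose A = mat 1"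
    "conj_transpose B ** B = mat 1" "B ** conj_transpose B = mat 1"
    by (auto simp: unitary_group_def unitary_matrix_def)
  have "conj_transpose B ** conj_transpose A ** (A ** B) =
      conj_transpose B ** (conj_transpose A ** A) ** B"
    by (simp only: matrix_mul_assoc)
  moreover have "A ** B ** (conj_transpose B ** conj_transpose A) =
      A ** (B ** conj_transpose B) ** conj_transpose A"
    by (simp only: matrix_mul_assoc)
  ultimately show "A \<otimes>\<^bsub>unitary_group\<^esub> B \<in> carrier unitary_group"
    using u by (simp add: unitary_group_def unitary_matrix_def conj_transpose_mult)
next
  fix A :: "'n cmat"
  assume "A \<in> carrier unitary_group"
  thus "\<exists>B\<in>carrier unitary_group. B \<otimes>\<^bsub>unitary_group\<^esub> A = \<one>\<^bsub>unitary_group\<^esub>"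
    by (intro bexI[of _ "conj_transpose A"])
       (auto simp: unitary_group_def unitary_matrix_def conj_transpose_involution)
qed (auto simp: unitary_group_def unitary_matrix_def matrix_mul_assoc conj_transpose_mat_1)

lemma peval_add: "peval (f + h) v = peval f v + peval h v"
  unfolding peval_def
  by (rule setsum_keys_plus_distrib) (simp_all add: algebra_simps)

lemma peval_0 [simp]: "peval 0 v = 0"
  by (simp add: peval_def)

lemma peval_sum: "peval (\<Sum>x\<in>A. f x) v = (\<Sum>x\<in>A. peval (f x) v)"
  by (induction A rule: infinite_finite_induct) (simp_all add: peval_add)

lemma peval_single:
  "peval (Poly_Mapping.single m c) v = c * (\<Prod>i\<in>UNIV. (v $ i) ^ Poly_Mapping.lookup m i)"
  by (cases "c = 0") (simp_all add: peval_def)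

lemma pol_eq_sum_single:
  "(\<Sum>m\<in>Poly_Mapping.keys f. Poly_Mapping.single m (Poly_Mapping.lookup f m)) = (f :: 'n pol)"
proof (rule poly_mapping_eqI)
  fix k
  show "Poly_Mapping.lookup (\<Sum>m\<in>Poly_Mapping.keys f.
      Poly_Mapping.single m (Poly_Mapping.lookup f m)) k = Poly_Mapping.lookup f k"
    by (simp add: lookup_sum lookup_single when_def in_keys_iff)
qed

lemma peval_mult: "peval (f * h) v = peval f v * peval h v"
proof -
  let ?k = Poly_Mapping.keys and ?s = Poly_Mapping.single and ?l = Poly_Mapping.lookup
  have "peval (f * h) v = peval ((\<Sum>m\<in>?k f. ?s m (?l f m)) * (\<Sum>m\<in>?k h. ?s m (?l h m))) v"
    by (simp only: pol_eq_sum_single)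
  also have "\<dots> = (\<Sum>m\<in>?k f. \<Sum>n\<in>?k h. peval (?s m (?l f m)) v * peval (?s n (?l h n)) v)"
    by (simp add: sum_product peval_sum mult_single peval_single lookup_add power_add
        prod.distrib algebra_simps)
  also have "\<dots> = peval (\<Sum>m\<in>?k f. ?s m (?l f m)) v * peval (\<Sum>m\<in>?k h. ?s m (?l h m)) v"
    by (simp add: sum_product peval_sum)
  finally show ?thesis by (simp only: pol_eq_sum_single)
qed

lemma peval_pconst [simp]: "peval (pconst c) v = c"
  by (simp add: pconst_def peval_single)

lemma peval_pvar [simp]: "peval (pvar i) v = v $ i"
proof -
  have "(\<Prod>j\<in>UNIV. (v $ j) ^ Poly_Mapping.lookup (Poly_Mapping.single i 1) j) =
      (\<Prod>j\<in>UNIV. if j = i then v $ j else 1)"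
    by (rule prod.cong) (auto simp: lookup_single when_def)
  thus ?thesis by (simp add: pvar_def peval_single)
qed

lemma peval_1 [simp]: "peval 1 v = 1"
  using peval_pconst[of 1 v] by (simp add: pconst_def)

lemma peval_power: "peval (f ^ k) v = peval f v ^ k"
  by (induction k) (simp_all add: peval_mult)

lemma peval_prod: "peval (\<Prod>x\<in>A. f x) v = (\<Prod>x\<in>A. peval (f x) v)"
  by (induction A rule: infinite_finite_induct) (simp_all add: peval_mult)

theorem peval_pact: "peval (pact g f) v = peval f (matrix_inv g *v v)"
proof -
  have "peval (pact g f) v = (\<Sum>m\<in>Poly_Mapping.keys f. Poly_Mapping.lookup f m *
      (\<Prod>i\<in>UNIV. (\<Sum>j\<in>UNIV. matrix_inv g $ i $ j * v $ j) ^ Poly_Mapping.lookup m i))"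
    by (simp add: pact_def psubst_def peval_sum peval_mult peval_prod peval_power)
  thus ?thesis by (simp add: peval_def[of f] matrix_vector_mult_def)
qed

lemma pconst_add: "pconst (a + b) = pconst a + pconst b"
  by (simp add: pconst_def single_add)

lemma psubst_add: "psubst \<sigma> (f + h) = psubst \<sigma> f + psubst \<sigma> h"
  unfolding psubst_def
  by (rule setsum_keys_plus_distrib) (simp_all add: pconst_add algebra_simps, simp add: pconst_def)

lemma psubst_0 [simp]: "psubst \<sigma> 0 = 0"
  by (simp add: psubst_def)

lemma psubst_sum: "psubst \<sigma> (\<Sum>x\<in>A. f x) = (\<Sum>x\<in>A. psubst \<sigma> (f x))"
  by (induction A rule: infinite_finite_induct) (simp_all add: psubst_add)

lemma psubst_single:
  "psubst \<sigma> (Poly_Mapping.single m c) = pconst c * (\<Prod>i\<in>UNIV. \<sigma> i ^ Poly_Mapping.lookup m i)"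
  by (cases "c = 0") (simp_all add: psubst_def pconst_def)

lemma pconst_mult: "pconst (a * b) = pconst a * pconst b"
  by (simp add: pconst_def mult_single)

lemma psubst_mult: "psubst \<sigma> (f * h) = psubst \<sigma> f * psubst \<sigma> h"
proof -
  let ?k = Poly_Mapping.keys and ?s = Poly_Mapping.single and ?l = Poly_Mapping.lookup
  have "psubst \<sigma> (f * h) = psubst \<sigma> ((\<Sum>m\<in>?k f. ?s m (?l f m)) * (\<Sum>m\<in>?k h. ?s m (?l h m)))"
    by (simp only: pol_eq_sum_single)
  also have "\<dots> = (\<Sum>m\<in>?k f. \<Sum>n\<in>?k h. psubst \<sigma> (?s m (?l f m)) * psubst \<sigma> (?s n (?l h n)))"
    by (simp add: sum_product psubst_sum mult_single psubst_single lookup_add power_add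
        prod.distrib pconst_mult mult_ac)
  also have "\<dots> = psubst \<sigma> (\<Sum>m\<in>?k f. ?s m (?l f m)) * psubst \<sigma> (\<Sum>m\<in>?k h. ?s m (?l h m))"
    by (simp add: sum_product psubst_sum)
  finally show ?thesis by (simp only: pol_eq_sum_single)
qed

lemma pact_add: "pact g (f + h) = pact g f + pact g h"
  by (simp add: pact_def psubst_add)

lemma pact_mult: "pact g (f * h) = pact g f * pact g h"
  by (simp add: pact_def psubst_mult)

lemma pact_0 [simp]: "pact g 0 = 0"
  by (simp add: pact_def)

text \<open>\<open>\<Omega>\<^sup>\<psi>\<close> is a module over the ring of invariant polynomials.\<close>

lemma chi_forms_of_degree_0: "(\<lambda>I. 0) \<in> chi_forms_of_degree G \<psi> p"
  by (simp add: chi_forms_of_degree_def forms_of_degree_def form_act_def fscale_def)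

lemma chi_forms_of_degree_add:
  assumes "\<mu> \<in> chi_forms_of_degree G \<psi> p" "\<omega> \<in> chi_forms_of_degree G \<psi> p"
  shows "(\<lambda>I. \<mu> I + \<omega> I) \<in> chi_forms_of_degree G \<psi> p"
  using assms
  by (auto simp: chi_forms_of_degree_def forms_of_degree_def form_act_def fscale_def
      pact_add fun_eq_iff algebra_simps sum.distrib)

lemma chi_forms_of_degree_scale:
  assumes "f \<in> invariant_pols G" "\<omega> \<in> chi_forms_of_degree G \<psi> p"
  shows "fscale f \<omega> \<in> chi_forms_of_degree G \<psi> p"
  using assms
  by (auto simp: chi_forms_of_degree_def forms_of_degree_def form_act_def fscale_def
      invariant_pols_def pact_mult fun_eq_iff mult.assoc mult.left_commute
      simp flip: sum_distrib_left)

theorem chi_forms_module: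
  shows "(\<lambda>I. 0) \<in> chi_forms G \<psi>"
    and "\<lbrakk>\<mu> \<in> chi_forms G \<psi>; \<omega> \<in> chi_forms G \<psi>\<rbrakk> \<Longrightarrow> (\<lambda>I. \<mu> I + \<omega> I) \<in> chi_forms G \<psi>"
    and "\<lbrakk>f \<in> invariant_pols G; \<omega> \<in> chi_forms G \<psi>\<rbrakk> \<Longrightarrow> fscale f \<omega> \<in> chi_forms G \<psi>"
proof -
  show "(\<lambda>I. 0) \<in> chi_forms G \<psi>"
    unfolding chi_forms_def
    by (intro CollectI exI[of _ "\<lambda>p I. 0"]) (simp add: chi_forms_of_degree_0)
next
  assume "\<mu> \<in> chi_forms G \<psi>" "\<omega> \<in> chi_forms G \<psi>"
  then obtain \<eta> \<theta> where
    "\<forall>p. \<eta> p \<in> chi_forms_of_degree G \<psi> p" "\<mu> = (\<lambda>I. \<Sum>p\<le>CARD('a). \<eta> p I)"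
    "\<forall>p. \<theta> p \<in> chi_forms_of_degree G \<psi> p" "\<omega> = (\<lambda>I. \<Sum>p\<le>CARD('a). \<theta> p I)"
    by (auto simp: chi_forms_def)
  thus "(\<lambda>I. \<mu> I + \<omega> I) \<in> chi_forms G \<psi>"
    unfolding chi_forms_def
    by (intro CollectI exI[of _ "\<lambda>p I. \<eta> p I + \<theta> p I"])
       (simp add: chi_forms_of_degree_add sum.distrib)
next
  assume f: "f \<in> invariant_pols G" and "\<omega> \<in> chi_forms G \<psi>"
  then obtain \<theta> where
    "\<forall>p. \<theta> p \<in> chi_forms_of_degree G \<psi> p" "\<omega> = (\<lambda>I. \<Sum>p\<le>CARD('a). \<theta> p I)"
    by (auto simp: chi_forms_def)
  thus "fscale f \<omega> \<in> chi_forms G \<psi>"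
    unfolding chi_forms_def using f
    by (intro CollectI exI[of _ "\<lambda>p. fscale f (\<theta> p)"])
       (simp add: chi_forms_of_degree_scale, simp add: fscale_def sum_distrib_left)
qed

lemma chi_wedge_eq:
  assumes "Q \<noteq> 0" "fscale Q \<eta> = wedge \<mu> \<omega>"
  shows "chi_wedge Q \<mu> \<omega> = \<eta>"
  unfolding chi_wedge_def
proof (rule the_equality)
  fix \<theta> assume "fscale Q \<theta> = wedge \<mu> \<omega>"
  with assms show "\<theta> = \<eta>" by (auto simp: fscale_def fun_eq_iff) (metis mult_cancel_left)
qed fact

lemma dpol_pvar: "dpol (pvar i) = (\<lambda>I. if I = {i} then 1 else 0)"
proof
  fix I :: "'a set"
  have p: "ppartial j (pvar i) = (if j = i then 1 else 0)" for j :: 'a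
    by (auto simp: ppartial_def pvar_def lookup_single)
  show "dpol (pvar i) I = (if I = {i} then 1 else 0)"
  proof -
    have "dpol (pvar i) I = (\<Sum>j\<in>UNIV. if j = i then (if I = {i} then 1 else 0) else 0)"
      unfolding dpol_def p by (rule sum.cong) auto
    thus ?thesis by simp
  qed
qed

lemma wedge_dpol_pvar:
  assumes "\<And>j. j \<in> J \<Longrightarrow> i < j"
  shows "wedge (dpol (pvar i)) (\<lambda>K. if K = J then 1 else 0) =
    (\<lambda>K. if K = insert i J then 1 else 0)"
proof
  fix K
  have iJ: "i \<notin> J" using assms by blast
  let ?t = "\<lambda>I. (- 1) ^ card {(i, j). i \<in> I \<and> j \<in> K - I \<and> j < i} *
     (dpol (pvar i) I * (if K - I = J then 1 else 0))"
  have z: "?t I = 0" if "I \<noteq> {i}" for I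
    using that by (simp add: dpol_pvar)
  have "wedge (dpol (pvar i)) (\<lambda>K. if K = J then 1 else 0) K = (\<Sum>I\<in>Pow K. ?t I)"
    by (simp add: wedge_def)
  also have "\<dots> = (\<Sum>I\<in>Pow K \<inter> {{i}}. ?t I)"
    by (rule sum.mono_neutral_right) (use z in auto)
  also have "\<dots> = (if K = insert i J then 1 else 0)"
  proof (cases "i \<in> K \<and> K - {i} = J")
    case True
    hence K: "K = insert i J" by blast
    have e: "{(a, j). a \<in> {i} \<and> j \<in> K - {i} \<and> j < a} = {}"
      using assms True by fastforce
    have P: "Pow K \<inter> {{i}} = {{i}}" using True by auto
    have "(\<Sum>I\<in>{{i}}. ?t I) = ?t {i}" by simp
    also have "\<dots> = 1" unfolding e using True by (simp add: dpol_pvar)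
    finally show ?thesis using K P by simp
  next
    case False
    hence K: "K \<noteq> insert i J" using iJ by auto
    have "(\<Sum>I\<in>Pow K \<inter> {{i}}. ?t I) = 0"
      by (rule sum.neutral) (use False in auto)
    with K show ?thesis by simp
  qed
  finally show "wedge (dpol (pvar i)) (\<lambda>K. if K = J then 1 else 0) K =
    (if K = insert i J then 1 else 0)" .
qed

text \<open>The wedge products \<open>dx\<^bsub>i\<^sub>1\<^esub> \<and> \<dots> \<and> dx\<^bsub>i\<^sub>p\<^esub>\<close> are the basis forms.\<close>

theorem dx_wedge_eq: "dx_wedge I = (\<lambda>K. if K = I then 1 else 0)"
proof -
  have "finite I" by simp
  thus ?thesis
  proof (induction I rule: finite_linorder_min_induct)
    case empty
    show ?case by (simp add: dx_wedge_def fone_def)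
  next
    case (insert b A)
    have "sorted_list_of_set (insert b A) = b # sorted_list_of_set A"
      using insert by (intro sorted_list_of_set_unique[THEN iffD1])
        (auto simp: sorted_list_of_set.idem_if_sorted_distinct less_imp_le strict_sorted_iff)
    hence "dx_wedge (insert b A) = wedge (dpol (pvar b)) (dx_wedge A)"
      by (simp add: dx_wedge_def)
    thus ?case using insert wedge_dpol_pvar[of A b] by simp
  qed
qed

end

theory Submission
  imports Defs "HOL-Computational_Algebra.Factorial_Ring"
begin

text \<open>
  Let \<open>s\<close> generate the pointwise stabilizer of a reflecting hyperplane \<open>H = ker \<alpha>\<close>, and put
  \<open>a = a\<^sub>H(\<psi>)\<close>. In coordinates with \<open>\<alpha> = x\<^sub>k\<close>, the coefficients of \<open>dx\<^sub>I\<close> with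
  \<open>k \<notin> I\<close> in a \<open>\<psi>\<close>-invariant form are \<open>\<psi>\<close>-semi-invariant under \<open>s\<close>, hence divisible by
  \<open>\<alpha>\<^sup>a\<close>. Each summand of a coefficient of \<open>\<mu> \<and> \<omega>\<close> is a product of coefficients with disjoint
  index sets, one of which avoids \<open>k\<close>, so \<open>\<alpha>\<^sup>a\<close> divides \<open>\<mu> \<and> \<omega>\<close>. The linear forms of
  different hyperplanes are non-associated primes, so \<open>Q\<^sub>\<psi>\<close> divides \<open>\<mu> \<and> \<omega>\<close>.

  Moreover \<open>gQ\<^sub>\<psi> = \<psi>(g) Q\<^sub>\<psi>\<close>: it suffices to take \<open>g = s\<close>, which permutes the other
  hyperplanes and so multiplies \<open>Q\<^sub>\<psi> / \<alpha>\<^sup>a\<close> by a scalar; this scalar is 1 because \<open>s\<close> acts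
  trivially modulo \<open>\<alpha>\<close>. As \<open>\<mu> \<and> \<omega>\<close> is \<open>\<psi>\<^sup>2\<close>-invariant, the quotient is
  \<open>\<psi>\<close>-invariant.
\<close>

subsection \<open>Polynomials, linear forms and substitution\<close>

lemma pconst_0 [simp]: "pconst 0 = 0"
  by (simp add: pconst_def)

lemma pconst_1 [simp]: "pconst 1 = 1"
  by (simp add: pconst_def)

lemma pconst_uminus: "pconst (- a) = - pconst a"
  by (simp add: pconst_def single_uminus)

lemma pconst_diff: "pconst (a - b) = pconst a - pconst b"
  by (simp add: pconst_def single_diff)

lemma pconst_power: "pconst (a ^ k) = pconst a ^ k"
  by (induction k) (simp_all add: pconst_mult)

lemma pconst_sum: "pconst (\<Sum>x\<in>A. f x) = (\<Sum>x\<in>A. pconst (f x))"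
  by (induction A rule: infinite_finite_induct) (simp_all add: pconst_add)

lemma dvd_pconst_mult_iff:
  assumes "c \<noteq> 0"
  shows "p dvd pconst c * f \<longleftrightarrow> p dvd f"
proof
  assume "p dvd pconst c * f"
  hence "p dvd pconst (1 / c) * (pconst c * f)" by (rule dvd_mult)
  also have "pconst (1 / c) * (pconst c * f) = pconst (1 / c * c) * f"
    by (simp only: pconst_mult mult.assoc)
  finally show "p dvd f" using assms by simp
qed simp

lemma psubst_pconst [simp]: "psubst \<sigma> (pconst c) = pconst c"
  by (simp add: pconst_def psubst_single)

lemma psubst_1 [simp]: "psubst \<sigma> 1 = 1"
  using psubst_pconst[of \<sigma> 1] by simp

lemma psubst_pvar [simp]: "psubst \<sigma> (pvar i) = \<sigma> i"
proof -
  have "(\<Prod>j\<in>UNIV. \<sigma> j ^ Poly_Mapping.lookup (Poly_Mapping.single i 1) j) =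
      (\<Prod>j\<in>UNIV. if j = i then \<sigma> j else 1)"
    by (rule prod.cong) (auto simp: lookup_single when_def)
  thus ?thesis by (simp add: pvar_def psubst_single)
qed

lemma psubst_power: "psubst \<sigma> (f ^ k) = psubst \<sigma> f ^ k"
  by (induction k) (simp_all add: psubst_mult)

lemma psubst_prod: "psubst \<sigma> (\<Prod>x\<in>A. f x) = (\<Prod>x\<in>A. psubst \<sigma> (f x))"
  by (induction A rule: infinite_finite_induct) (simp_all add: psubst_mult)

lemma psubst_psubst: "psubst \<tau> (psubst \<sigma> f) = psubst (\<lambda>i. psubst \<tau> (\<sigma> i)) f"
  unfolding psubst_def[of \<sigma> f] psubst_def[of "\<lambda>i. psubst \<tau> (\<sigma> i)" f]
  by (simp add: psubst_sum psubst_mult psubst_prod psubst_power)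

lemma prod_pvar_power:
  fixes m :: "'n::finite \<Rightarrow>\<^sub>0 nat"
  shows "(\<Prod>i\<in>UNIV. pvar i ^ Poly_Mapping.lookup m i) = Poly_Mapping.single m 1"
proof -
  have pow: "pvar i ^ k = Poly_Mapping.single (Poly_Mapping.single i k) 1" for i :: 'n and k
    by (induction k) (simp_all add: pvar_def mult_single single_add[symmetric])
  have "(\<Prod>i\<in>A. pvar i ^ Poly_Mapping.lookup m i) =
      Poly_Mapping.single (\<Sum>i\<in>A. Poly_Mapping.single i (Poly_Mapping.lookup m i)) 1" for A :: "'n set"
    by (induction A rule: infinite_finite_induct) (simp_all add: pow mult_single)
  moreover have "(\<Sum>i\<in>UNIV. Poly_Mapping.single i (Poly_Mapping.lookup m i)) = m"
    by (rule poly_mapping_eqI) (simp add: lookup_sum lookup_single when_def)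
  ultimately show ?thesis by simp
qed

lemma psubst_pvar_id: "psubst pvar f = f"
proof -
  have "psubst pvar f = (\<Sum>m\<in>Poly_Mapping.keys f. Poly_Mapping.single m (Poly_Mapping.lookup f m))"
    by (simp add: psubst_def prod_pvar_power) (simp add: pconst_def mult_single)
  thus ?thesis by (simp add: pol_eq_sum_single)
qed

lemma dvd_prod_diff:
  fixes p :: "'a::comm_ring_1"
  assumes "\<And>x. x \<in> A \<Longrightarrow> p dvd f x - h x"
  shows "p dvd (\<Prod>x\<in>A. f x) - (\<Prod>x\<in>A. h x)"
  using assms
proof (induction A rule: infinite_finite_induct)
  case (insert x A)
  have "(\<Prod>x\<in>insert x A. f x) - (\<Prod>x\<in>insert x A. h x) =
      (f x - h x) * (\<Prod>x\<in>A. f x) + h x * ((\<Prod>x\<in>A. f x) - (\<Prod>x\<in>A. h x))"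
    using insert.hyps by (simp add: algebra_simps)
  thus ?case using insert by (simp add: dvd_add)
qed auto

text \<open>Congruence modulo \<open>p\<close> is respected by sums, products and powers, hence by
  every polynomial expression. This serves both to compute modulo a linear form and to show that a
  matrix fixing a hyperplane acts trivially modulo its form.\<close>

lemma psubst_cong_dvd:
  fixes p :: "'n::finite pol"
  assumes "\<And>i. p dvd \<sigma> i - \<tau> i"
  shows "p dvd psubst \<sigma> f - psubst \<tau> f"
proof -
  have pow: "p dvd \<sigma> i ^ k - \<tau> i ^ k" for i k
    using dvd_prod_diff[of "{..<k}" p "\<lambda>_. \<sigma> i" "\<lambda>_. \<tau> i"] assms by simp
  have "psubst \<sigma> f - psubst \<tau> f = (\<Sum>m\<in>Poly_Mapping.keys f. pconst (Poly_Mapping.lookup f m) *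
      ((\<Prod>i\<in>UNIV. \<sigma> i ^ Poly_Mapping.lookup m i) - (\<Prod>i\<in>UNIV. \<tau> i ^ Poly_Mapping.lookup m i)))"
    by (simp add: psubst_def sum_subtractf algebra_simps)
  thus ?thesis
    by (simp only:) (intro dvd_sum dvd_mult dvd_prod_diff pow)
qed

section \<open>Linear forms and their coefficient vectors\<close>

definition linpol :: "'n::finite cvec \<Rightarrow> 'n pol" where
  "linpol c = (\<Sum>i\<in>UNIV. pconst (c $ i) * pvar i)"

text \<open>The pairing is bilinear, without complex conjugation: it has to agree with evaluating
  the polynomial \<open>linpol c\<close> at \<open>v\<close>.\<close>

definition dotp :: "'n::finite cvec \<Rightarrow> 'n cvec \<Rightarrow> complex" where
  "dotp c v = (\<Sum>i\<in>UNIV. c $ i * v $ i)"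

lemma linear_form_iff: "linear_form f \<longleftrightarrow> (\<exists>c. f = linpol c)"
  by (simp add: linear_form_def linpol_def)

lemma peval_linpol [simp]: "peval (linpol c) v = dotp c v"
  by (simp add: linpol_def dotp_def peval_sum peval_mult)

lemma dotp_axis [simp]: "dotp c (axis i 1) = c $ i" "dotp (axis i 1) c = c $ i"
  by (simp_all add: dotp_def axis_def if_distrib[of "\<lambda>x. _ * x"] if_distrib[of "\<lambda>x. x * _"] cong: if_cong)

lemma dotp_simps:
  "dotp c (v + w) = dotp c v + dotp c w" "dotp c (v - w) = dotp c v - dotp c w"
  "dotp c (k *s v) = k * dotp c v" "dotp c 0 = 0"
  by (simp_all add: dotp_def algebra_simps sum.distrib sum_subtractf sum_distrib_left)

lemma linpol_axis [simp]: "linpol (axis i 1) = pvar i"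
  by (simp add: linpol_def axis_def if_distrib[of pconst] if_distrib[of "\<lambda>x. x * _"] cong: if_cong)

lemma linpol_scale: "linpol (k *s c) = pconst k * linpol c"
  by (simp add: linpol_def pconst_mult sum_distrib_left mult.assoc)

lemma linpol_diff: "linpol (c - d) = linpol c - linpol d"
  by (simp add: linpol_def pconst_diff sum_subtractf algebra_simps)

lemma psubst_linpol: "psubst \<sigma> (linpol c) = (\<Sum>i\<in>UNIV. pconst (c $ i) * \<sigma> i)"
  by (simp add: linpol_def psubst_sum psubst_mult)

text \<open>Substituting so that \<open>linpol c\<close> becomes 0 realizes the quotient by it as a polynomial ring.\<close>

lemma linpol_dvd_iff:
  assumes "c $ k \<noteq> 0"
  obtains \<sigma> where "\<And>f. linpol c dvd f \<longleftrightarrow> psubst \<sigma> f = 0"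
proof
  \<comment> \<open>The equation \<open>linpol c = 0\<close> is solved for the variable with index
    \<open>k\<close>; the other variables stay fixed, so \<open>\<sigma>\<close> is the identity
    modulo \<open>linpol c\<close>.\<close>
  define \<sigma> where "\<sigma> i = (if i = k then pvar k - pconst (1 / c $ k) * linpol c else pvar i)" for i
  have "psubst \<sigma> (linpol c) = (\<Sum>i\<in>UNIV. pconst (c $ i) * pvar i -
      (if i = k then pconst (c $ k) * (pconst (1 / c $ k) * linpol c) else 0))"
    unfolding psubst_linpol by (rule sum.cong) (auto simp: \<sigma>_def algebra_simps)
  also have "\<dots> = linpol c - pconst (c $ k * (1 / c $ k)) * linpol c"
    unfolding pconst_mult mult.assoc by (simp add: sum_subtractf flip: linpol_def)
  also have "\<dots> = 0" using assms by simp
  finally have 0: "psubst \<sigma> (linpol c) = 0" .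
  fix f
  show "linpol c dvd f \<longleftrightarrow> psubst \<sigma> f = 0"
  proof
    assume "linpol c dvd f"
    thus "psubst \<sigma> f = 0" using 0 by (auto simp: psubst_mult)
  next
    assume f: "psubst \<sigma> f = 0"
    have "linpol c dvd psubst pvar f - psubst \<sigma> f"
      by (rule psubst_cong_dvd) (simp add: \<sigma>_def)
    thus "linpol c dvd f" by (simp add: f psubst_pvar_id)
  qed
qed

text \<open>Divisibility by \<open>linpol c\<close> is membership in the kernel of a ring
  homomorphism into the polynomial ring, which is a domain.\<close>

lemma prime_elem_linpol:
  fixes c :: "'n::{finite,linorder} cvec"
  assumes "c \<noteq> 0"
  shows "prime_elem (linpol c)"
proof -
  from assms obtain k where k: "c $ k \<noteq> 0" by (auto simp: vec_eq_iff)
  from linpol_dvd_iff[of c k] k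
  obtain \<sigma> where \<sigma>: "\<And>f. linpol c dvd f \<longleftrightarrow> psubst \<sigma> f = 0" by blast
  show ?thesis
  proof (rule prime_elemI)
    show "linpol c \<noteq> 0"
    proof
      assume "linpol c = 0"
      hence "dotp c (axis k 1) = 0" using peval_linpol[of c "axis k 1"] by simp
      with k show False by simp
    qed
    show "\<not> linpol c dvd 1" by (simp add: \<sigma>)
    show "linpol c dvd a \<or> linpol c dvd b" if "linpol c dvd a * b" for a b
      using that by (simp add: \<sigma> psubst_mult)
  qed
qed

text \<open>If \<open>c $ j \<noteq> 0\<close>, the vectors
  \<open>axis i 1 - (c $ i / c $ j) *s axis j 1\<close> lie in the kernel of \<open>c\<close>;
  evaluating \<open>d\<close> on them expresses each \<open>d $ i\<close> through
  \<open>d $ j\<close>.\<close>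

lemma proportional_if_kernel_subset:
  assumes "\<And>v. dotp c v = 0 \<Longrightarrow> dotp d v = 0"
  obtains k where "d = k *s c"
proof (cases "c = 0")
  case True
  hence "d $ i = 0" for i
    using assms[of "axis i 1"] by simp
  hence "d = 0 *s c" by (simp add: vec_eq_iff)
  thus ?thesis by (rule that)
next
  case False
  then obtain j where j: "c $ j \<noteq> 0" by (auto simp: vec_eq_iff)
  define k where "k = d $ j / c $ j"
  have "d $ i = k * c $ i" for i
  proof -
    have "dotp c (axis i 1 - (c $ i / c $ j) *s axis j 1) = 0"
      using j by (simp add: dotp_simps)
    from assms[OF this] show ?thesis by (simp add: dotp_simps k_def)
  qed
  hence "d = k *s c" by (simp add: vec_eq_iff)
  thus ?thesis by (rule that)
qed

subsection \<open>The action on polynomials\<close>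

lemma pact_psubst: "pact g = psubst (\<lambda>i. linpol (row i (matrix_inv g)))"
  by (simp add: pact_def linpol_def row_def fun_eq_iff)

lemma pact_pconst [simp]: "pact g (pconst c) = pconst c"
  by (simp add: pact_psubst)

lemma pact_1 [simp]: "pact g 1 = 1"
  by (simp add: pact_psubst)

lemma pact_pvar: "pact g (pvar i) = linpol (row i (matrix_inv g))"
  by (simp add: pact_psubst)

lemma pact_sum: "pact g (\<Sum>x\<in>A. f x) = (\<Sum>x\<in>A. pact g (f x))"
  by (simp add: pact_psubst psubst_sum)

lemma pact_prod: "pact g (\<Prod>x\<in>A. f x) = (\<Prod>x\<in>A. pact g (f x))"
  by (simp add: pact_psubst psubst_prod)

lemma pact_power: "pact g (f ^ k) = pact g f ^ k"
  by (simp add: pact_psubst psubst_power)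

lemma pact_linpol: "pact g (linpol c) = linpol (c v* matrix_inv g)"
proof -
  have "pact g (linpol c) = (\<Sum>i\<in>UNIV. \<Sum>j\<in>UNIV. pconst (c $ i * matrix_inv g $ i $ j) * pvar j)"
    by (simp add: pact_psubst psubst_linpol) (simp add: linpol_def row_def sum_distrib_left pconst_mult mult.assoc)
  also have "\<dots> = (\<Sum>j\<in>UNIV. \<Sum>i\<in>UNIV. pconst (c $ i * matrix_inv g $ i $ j) * pvar j)"
    by (rule sum.swap)
  also have "\<dots> = linpol (c v* matrix_inv g)"
    by (simp add: linpol_def vector_matrix_mult_def pconst_sum sum_distrib_right
        mult.commute[of "matrix_inv g $ _ $ _"])
  finally show ?thesis .
qed

section \<open>Inverse matrices and composition of the action\<close>

lemma matrix_inv_unique: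
  fixes A B :: "'n::finite cmat"
  assumes "A ** B = mat 1"
  shows "matrix_inv A = B"
proof -
  have BA: "B ** A = mat 1" using assms by (simp add: matrix_left_right_inverse)
  hence "invertible A" using assms by (auto simp: invertible_def)
  hence "matrix_inv A ** A = mat 1"
    unfolding invertible_def matrix_inv_def by (rule someI2_ex) simp
  hence "matrix_inv A ** (A ** B) = B" by (simp add: matrix_mul_assoc)
  thus ?thesis using assms by simp
qed

lemma matrix_inv_inverse:
  fixes A :: "'n::finite cmat"
  assumes "invertible A"
  shows "A ** matrix_inv A = mat 1" "matrix_inv A ** A = mat 1"
  using assms matrix_inv_unique[of A] by (auto simp: invertible_def)

lemma matrix_inv_mult:
  fixes A B :: "'n::finite cmat"
  assumes "invertible A" "invertible B"
  shows "matrix_inv (A ** B) = matrix_inv B ** matrix_inv A"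
proof (rule matrix_inv_unique)
  have "A ** B ** (matrix_inv B ** matrix_inv A) = A ** (B ** matrix_inv B) ** matrix_inv A"
    by (simp only: matrix_mul_assoc)
  thus "A ** B ** (matrix_inv B ** matrix_inv A) = mat 1"
    using assms by (simp add: matrix_inv_inverse)
qed

lemma matrix_inv_mat_1 [simp]: "matrix_inv (mat 1) = (mat 1 :: 'n::finite cmat)"
  by (rule matrix_inv_unique) simp

lemma row_mult: "row i A v* B = row i (A ** B)" for A :: "'n::finite cmat"
  by (simp add: vec_eq_iff row_def vector_matrix_mult_def matrix_matrix_mult_def mult.commute)

lemma pact_pact:
  assumes "invertible A" "invertible B"
  shows "pact A (pact B f) = pact (A ** B) f"
proof -
  have "pact A (pact B f) = psubst (\<lambda>i. pact A (linpol (row i (matrix_inv B)))) f"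
    unfolding pact_psubst psubst_psubst ..
  also have "\<dots> = pact (A ** B) f"
    using assms by (simp add: pact_psubst[of "A ** B"] pact_linpol row_mult matrix_inv_mult)
  finally show ?thesis .
qed

lemma pact_mat_1 [simp]: "pact (mat 1) f = f"
proof -
  have "row i (mat 1 :: 'a cmat) = axis i 1" for i
    by (auto simp: vec_eq_iff row_def mat_def axis_def)
  thus ?thesis by (simp add: pact_psubst psubst_pvar_id)
qed

subsection \<open>The exterior algebra\<close>

text \<open>For disjoint \<open>I\<close> and \<open>J\<close> this is the sign of the permutation
  that sorts \<open>I\<close> followed by \<open>J\<close>. It is a polynomial, so that it can
  multiply coefficients directly.\<close>

definition inv_sign :: "'n::{finite,linorder} set \<Rightarrow> 'n set \<Rightarrow> 'n pol" where
  "inv_sign I J = (- 1) ^ card {(i, j). i \<in> I \<and> j \<in> J \<and> j < i}"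

lemma inv_sign_Un_right:
  assumes "J \<inter> M = {}"
  shows "inv_sign I (J \<union> M) = inv_sign I J * inv_sign I M"
proof -
  have "{(i, j). i \<in> I \<and> j \<in> J \<union> M \<and> j < i} =
      {(i, j). i \<in> I \<and> j \<in> J \<and> j < i} \<union> {(i, j). i \<in> I \<and> j \<in> M \<and> j < i}" by auto
  thus ?thesis using assms
    by (simp add: inv_sign_def card_Un_disjoint disjoint_iff power_add)
qed

lemma inv_sign_Un_left:
  assumes "I \<inter> J = {}"
  shows "inv_sign (I \<union> J) M = inv_sign I M * inv_sign J M"
proof -
  have "{(i, j). i \<in> I \<union> J \<and> j \<in> M \<and> j < i} =
      {(i, j). i \<in> I \<and> j \<in> M \<and> j < i} \<union> {(i, j). i \<in> J \<and> j \<in> M \<and> j < i}" by auto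
  thus ?thesis using assms
    by (simp add: inv_sign_def card_Un_disjoint disjoint_iff power_add)
qed

lemma inv_sign_eq_1:
  assumes "\<And>i j. i \<in> I \<Longrightarrow> j \<in> J \<Longrightarrow> i \<le> j"
  shows "inv_sign I J = 1"
proof -
  have e: "{(i, j). i \<in> I \<and> j \<in> J \<and> j < i} = {}" using assms by fastforce
  show ?thesis unfolding inv_sign_def e by simp
qed

lemma inv_sign_empty [simp]: "inv_sign {} J = 1" "inv_sign I {} = 1"
  by (rule inv_sign_eq_1, simp)+

lemma inv_sign_singleton: "inv_sign {i} {j} = (if j < i then - 1 else 1)"
proof -
  have "{(a, b). a \<in> {i} \<and> b \<in> {j} \<and> b < a} = (if j < i then {(i, j)} else {})" by auto
  thus ?thesis by (simp add: inv_sign_def)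
qed

lemma inv_sign_insert_right:
  "j \<notin> J \<Longrightarrow> inv_sign I (insert j J) = inv_sign I {j} * inv_sign I J"
  using inv_sign_Un_right[of "{j}" J I] by simp

lemma inv_sign_insert_left:
  "i \<notin> I \<Longrightarrow> inv_sign (insert i I) J = inv_sign {i} J * inv_sign I J"
  using inv_sign_Un_left[of "{i}" I J] by simp

lemma pact_inv_sign [simp]: "pact g (inv_sign I J) = inv_sign I J"
proof -
  have "inv_sign I J = pconst ((- 1) ^ card {(i, j). i \<in> I \<and> j \<in> J \<and> j < i})"
    by (simp add: inv_sign_def pconst_power pconst_uminus)
  thus ?thesis by simp
qed

lemma wedge_eq: "wedge \<mu> \<omega> K = (\<Sum>I\<in>Pow K. inv_sign I (K - I) * (\<mu> I * \<omega> (K - I)))"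
  by (simp add: wedge_def inv_sign_def)

lemma wedge_sum_left: "wedge (\<lambda>I. \<Sum>x\<in>A. f x I) \<omega> = (\<lambda>K. \<Sum>x\<in>A. wedge (f x) \<omega> K)"
  unfolding fun_eq_iff wedge_eq
  by (simp add: sum_distrib_left sum_distrib_right) (intro allI sum.swap)

lemma wedge_sum_right: "wedge \<mu> (\<lambda>I. \<Sum>x\<in>A. f x I) = (\<lambda>K. \<Sum>x\<in>A. wedge \<mu> (f x) K)"
  unfolding fun_eq_iff wedge_eq
  by (simp add: sum_distrib_left sum_distrib_right) (intro allI sum.swap)

lemma wedge_fscale_left: "wedge (fscale f \<mu>) \<omega> = fscale f (wedge \<mu> \<omega>)"
  by (simp add: fun_eq_iff wedge_eq fscale_def sum_distrib_left algebra_simps)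

lemma wedge_fscale_right: "wedge \<mu> (fscale f \<omega>) = fscale f (wedge \<mu> \<omega>)"
  by (simp add: fun_eq_iff wedge_eq fscale_def sum_distrib_left algebra_simps)

lemma fscale_fscale: "fscale f (fscale h \<omega>) = fscale (f * h) \<omega>"
  by (simp add: fscale_def mult.assoc)

lemma wedge_zero_right [simp]: "wedge \<mu> (\<lambda>_. 0) = (\<lambda>_. 0)"
  by (simp add: fun_eq_iff wedge_eq)

text \<open>Lets forms be compared on the subsets of a fixed \<open>K\<close> alone, that is, modulo
  the differentials with index outside \<open>K\<close>.\<close>

lemma wedge_cong:
  assumes "\<And>I. I \<subseteq> K \<Longrightarrow> \<mu> I = \<mu>' I" "\<And>I. I \<subseteq> K \<Longrightarrow> \<omega> I = \<omega>' I"
  shows "wedge \<mu> \<omega> K = wedge \<mu>' \<omega>' K"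
  unfolding wedge_eq by (rule sum.cong) (use assms in auto)

lemma wedge_fone_left [simp]: "wedge fone \<omega> = \<omega>"
proof
  fix K
  have "wedge fone \<omega> K = (\<Sum>I\<in>{{}}. inv_sign I (K - I) * (fone I * \<omega> (K - I)))"
    unfolding wedge_eq by (rule sum.mono_neutral_right) (auto simp: fone_def)
  thus "wedge fone \<omega> K = \<omega> K" by (simp add: fone_def)
qed

lemma wedge_fone_right [simp]: "wedge \<omega> fone = \<omega>"
proof
  fix K
  have "wedge \<omega> fone K = (\<Sum>I\<in>{K}. inv_sign I (K - I) * (\<omega> I * fone (K - I)))"
    unfolding wedge_eq by (rule sum.mono_neutral_right) (auto simp: fone_def)
  thus "wedge \<omega> fone K = \<omega> K" by (simp add: fone_def)
qed

text \<open>Both sides are sums over the ways to split \<open>K\<close> into three disjoint pieces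
  \<open>I\<close>, \<open>J\<close>, \<open>M\<close>, and both signs equal the product of the
  three pairwise signs.\<close>

lemma wedge_assoc: "wedge (wedge \<kappa> \<mu>) \<omega> = wedge \<kappa> (wedge \<mu> \<omega>)"
proof
  fix K
  have "wedge (wedge \<kappa> \<mu>) \<omega> K = (\<Sum>(L, I)\<in>Sigma (Pow K) Pow.
      inv_sign I (L - I) * inv_sign L (K - L) * (\<kappa> I * \<mu> (L - I) * \<omega> (K - L)))"
    unfolding wedge_eq by (simp add: sum_distrib_left sum_distrib_right sum.Sigma mult_ac)
  also have "\<dots> = (\<Sum>(I, J)\<in>Sigma (Pow K) (\<lambda>I. Pow (K - I)).
      inv_sign I (K - I) * inv_sign J (K - I - J) * (\<kappa> I * \<mu> J * \<omega> (K - I - J)))"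
  proof (rule sum.reindex_bij_witness[of _ "\<lambda>(I, J). (I \<union> J, I)" "\<lambda>(L, I). (I, L - I)"])
    fix x assume "x \<in> Sigma (Pow K) Pow"
    then obtain L I where x: "x = (L, I)" and LI: "I \<subseteq> L" "L \<subseteq> K" by auto
    define J M where "J = L - I" and "M = K - L"
    have e: "L = I \<union> J" "K - I = J \<union> M" "K - I - J = M" "K - L = M" "L - I = J"
      and d: "I \<inter> J = {}" "J \<inter> M = {}" using LI by (auto simp: J_def M_def)
    show "(case case x of (L, I) \<Rightarrow> (I, L - I) of (I, J) \<Rightarrow>
        inv_sign I (K - I) * inv_sign J (K - I - J) * (\<kappa> I * \<mu> J * \<omega> (K - I - J))) =
      (case x of (L, I) \<Rightarrow> inv_sign I (L - I) * inv_sign L (K - L) *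
        (\<kappa> I * \<mu> (L - I) * \<omega> (K - L)))"
      \<comment> \<open>The order matters: rewriting \<open>K - I\<close> first would destroy the
        pattern \<open>K - I - J\<close>, and rewriting \<open>L\<close> first the patterns
        \<open>L - I\<close> and \<open>K - L\<close>.\<close>
      unfolding x case_prod_conv e(5) e(4) e(3) unfolding e(2) unfolding e(1)
      by (simp add: inv_sign_Un_right inv_sign_Un_left d mult_ac)
  qed auto
  also have "\<dots> = wedge \<kappa> (wedge \<mu> \<omega>) K"
    unfolding wedge_eq by (simp add: sum_distrib_left sum_distrib_right sum.Sigma mult_ac)
  finally show "wedge (wedge \<kappa> \<mu>) \<omega> K = wedge \<kappa> (wedge \<mu> \<omega>) K" .
qed

section \<open>Degrees and products of one-forms\<close>

lemma wedge_degree: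
  assumes "\<mu> \<in> forms_of_degree p" "\<omega> \<in> forms_of_degree q"
  shows "wedge \<mu> \<omega> \<in> forms_of_degree (p + q)"
  unfolding forms_of_degree_def
proof (intro CollectI allI impI)
  fix K :: "'a set" assume K: "card K \<noteq> p + q"
  show "wedge \<mu> \<omega> K = 0"
    unfolding wedge_eq
  proof (rule sum.neutral, rule ballI)
    fix I assume "I \<in> Pow K"
    hence "card (K - I) = card K - card I" "card I \<le> card K"
      by (simp_all add: card_Diff_subset card_mono)
    with K have "card I \<noteq> p \<or> card (K - I) \<noteq> q" by auto
    thus "inv_sign I (K - I) * (\<mu> I * \<omega> (K - I)) = 0"
      using assms by (auto simp: forms_of_degree_def)
  qed
qed

text \<open>Exchanging \<open>I\<close> with \<open>K - I\<close> swaps the factors. Only splittings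
  into two singletons contribute, and exactly one of the two orders of distinct indices is an
  inversion.\<close>

lemma wedge_one_forms_anticommute:
  assumes "\<theta> \<in> forms_of_degree 1" "\<eta> \<in> forms_of_degree 1"
  shows "wedge \<theta> \<eta> K = - wedge \<eta> \<theta> K"
proof -
  have "wedge \<theta> \<eta> K = (\<Sum>I\<in>Pow K. - (inv_sign I (K - I) * (\<eta> I * \<theta> (K - I))))"
    unfolding wedge_eq
  proof (rule sum.reindex_bij_witness[of _ "\<lambda>I. K - I" "\<lambda>I. K - I"])
    fix I assume "I \<in> Pow K"
    hence KI: "K - (K - I) = I" by auto
    have "inv_sign (K - I) I = - inv_sign I (K - I)" if "\<theta> I \<noteq> 0" "\<eta> (K - I) \<noteq> 0"
    proof -
      from that assms have "card I = 1" "card (K - I) = 1"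
        by (auto simp: forms_of_degree_def)
      then obtain a b where ab: "I = {a}" "K - I = {b}" by (auto simp: card_1_singleton_iff)
      have "a \<noteq> b" using ab by auto
      thus ?thesis unfolding ab(2) unfolding ab(1) by (auto simp: inv_sign_singleton)
    qed
    thus "- (inv_sign (K - I) (K - (K - I)) * (\<eta> (K - I) * \<theta> (K - (K - I)))) =
        inv_sign I (K - I) * (\<theta> I * \<eta> (K - I))"
      unfolding KI by (cases "\<theta> I = 0 \<or> \<eta> (K - I) = 0") (auto simp: mult_ac)
  qed auto
  thus ?thesis by (simp add: sum_negf wedge_eq)
qed

lemma wedge_one_form_self:
  assumes "\<theta> \<in> forms_of_degree 1"
  shows "wedge \<theta> \<theta> = (\<lambda>_. 0)"
proof
  fix K
  have "2 * wedge \<theta> \<theta> K = 0"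
    using wedge_one_forms_anticommute[OF assms assms, of K] by (metis mult_2 add.left_inverse)
  thus "wedge \<theta> \<theta> K = 0" by simp
qed

text \<open>The ordered products of an arbitrary family of forms. With \<open>\<theta> i\<close>
  equal to the image of \<open>dx_i\<close> under \<open>g\<close> this is
  \<open>act_dx_wedge g\<close>, so facts about such products apply to the action.\<close>

definition wedge_family :: "('n \<Rightarrow> 'n form) \<Rightarrow> 'n::{finite,linorder} set \<Rightarrow> 'n form" where
  "wedge_family \<theta> I = foldr (\<lambda>i. wedge (\<theta> i)) (sorted_list_of_set I) fone"

lemma wedge_family_empty [simp]: "wedge_family \<theta> {} = fone"
  by (simp add: wedge_family_def)

lemma wedge_family_insert_min:
  assumes "\<And>j. j \<in> I \<Longrightarrow> i < j"
  shows "wedge_family \<theta> (insert i I) = wedge (\<theta> i) (wedge_family \<theta> I)"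
proof -
  have "i \<notin> I" using assms by blast
  hence "sorted_list_of_set (insert i I) = i # sorted_list_of_set I"
    using assms by (intro sorted_list_of_set_unique[THEN iffD1])
      (auto simp: sorted_list_of_set.idem_if_sorted_distinct less_imp_le strict_sorted_iff)
  thus ?thesis by (simp add: wedge_family_def)
qed

text \<open>Peels off the smallest index, which is the leftmost factor in
  \<open>wedge_family\<close>; finiteness of the set comes from its type.\<close>

lemma finite_linorder_min_induct_set [case_names empty insert]:
  fixes A :: "'n::{finite,linorder} set"
  assumes "P {}" "\<And>b A. (\<And>a. a \<in> A \<Longrightarrow> b < a) \<Longrightarrow> P A \<Longrightarrow> P (insert b A)"
  shows "P A"
proof -
  have "finite A" by simp
  thus ?thesis by (induction A rule: finite_linorder_min_induct) (use assms in auto)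
qed

lemma wedge_family_degree:
  assumes "\<And>i. \<theta> i \<in> forms_of_degree 1"
  shows "wedge_family \<theta> I \<in> forms_of_degree (card I)"
proof (induction I rule: finite_linorder_min_induct_set)
  case empty
  show ?case by (auto simp: fone_def forms_of_degree_def)
next
  case (insert b A)
  have "b \<notin> A" using insert(1) by blast
  hence "card (insert b A) = 1 + card A" by simp
  moreover have "wedge_family \<theta> (insert b A) = wedge (\<theta> b) (wedge_family \<theta> A)"
    using insert(1) by (rule wedge_family_insert_min)
  ultimately show ?case using wedge_degree[OF assms[of b] insert(2)] by simp
qed

text \<open>The factor \<open>\<theta> i\<close> moves to the right until it reaches its place: each
  factor of smaller index that it passes costs one sign, and meeting its equal gives 0.\<close>

lemma wedge_one_form_family:
  assumes \<theta>: "\<And>i. \<theta> i \<in> forms_of_degree 1"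
  shows "wedge (\<theta> i) (wedge_family \<theta> J) =
    (if i \<in> J then (\<lambda>_. 0) else fscale (inv_sign {i} J) (wedge_family \<theta> (insert i J)))"
proof (induction J rule: finite_linorder_min_induct_set)
  case empty
  show ?case using wedge_family_insert_min[of "{}" i \<theta>] by (simp add: fscale_def)
next
  case (insert b A)
  have family: "wedge_family \<theta> (insert b A) = wedge (\<theta> b) (wedge_family \<theta> A)"
    using insert(1) by (rule wedge_family_insert_min)
  have bA: "b \<notin> A" using insert(1) by blast
  consider "i < b" | "i = b" | "b < i" by fastforce
  thus ?case
  proof cases
    case 1
    hence lt: "i < j" if "j \<in> insert b A" for j using that insert(1)[of j] by auto
    hence "i \<notin> insert b A" "inv_sign {i} (insert b A) = 1"
      by (blast, intro inv_sign_eq_1) (use lt in \<open>auto simp: less_imp_le\<close>)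
    thus ?thesis using wedge_family_insert_min[of "insert b A" i \<theta>] lt by (simp add: fscale_def)
  next
    case 2
    thus ?thesis
      by (simp add: family wedge_one_form_self[OF \<theta>] flip: wedge_assoc)
        (simp add: fun_eq_iff wedge_eq)
  next
    case 3
    have neg: "wedge (\<theta> i) (\<theta> b) = fscale (- 1) (wedge (\<theta> b) (\<theta> i))"
      using wedge_one_forms_anticommute[OF \<theta> \<theta>, of i b] by (simp add: fun_eq_iff fscale_def)
    have "wedge (\<theta> i) (wedge_family \<theta> (insert b A)) =
        fscale (- 1) (wedge (\<theta> b) (wedge (\<theta> i) (wedge_family \<theta> A)))"
      unfolding family by (simp add: neg wedge_fscale_left flip: wedge_assoc)
    also have "\<dots> = (if i \<in> insert b A then (\<lambda>_. 0)
        else fscale (inv_sign {i} (insert b A)) (wedge_family \<theta> (insert i (insert b A))))"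
    proof (cases "i \<in> A")
      case True
      thus ?thesis using insert(2) by (simp add: fscale_def)
    next
      case False
      have "wedge_family \<theta> (insert b (insert i A)) = wedge (\<theta> b) (wedge_family \<theta> (insert i A))"
        by (rule wedge_family_insert_min) (use insert(1) 3 in auto)
      moreover have "inv_sign {i} (insert b A) = - inv_sign {i} A"
        using 3 by (simp add: inv_sign_insert_right[OF bA] inv_sign_singleton)
      moreover have "i \<noteq> b" using 3 by simp
      ultimately show ?thesis using False insert(2)
        by (simp add: wedge_fscale_right insert_commute[of i b]) (simp add: fscale_def)
    qed
    finally show ?thesis .
  qed
qed

text \<open>Any family of one-forms multiplies by the same rule as the \<open>dx_i\<close>, because
  only anticommutativity enters. This is the source of the multiplicativity of the action.\<close>

lemma wedge_family_mult:
  assumes \<theta>: "\<And>i. \<theta> i \<in> forms_of_degree 1"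
  shows "wedge (wedge_family \<theta> I) (wedge_family \<theta> J) =
    (if I \<inter> J = {} then fscale (inv_sign I J) (wedge_family \<theta> (I \<union> J)) else (\<lambda>_. 0))"
proof (induction I rule: finite_linorder_min_induct_set)
  case empty
  show ?case by (simp add: fscale_def)
next
  case (insert b A)
  have bA: "b \<notin> A" using insert(1) by blast
  have eq: "wedge (wedge_family \<theta> (insert b A)) (wedge_family \<theta> J) =
      wedge (\<theta> b) (wedge (wedge_family \<theta> A) (wedge_family \<theta> J))"
    using insert(1) by (simp add: wedge_family_insert_min wedge_assoc)
  show ?case
  proof (cases "A \<inter> J = {}")
    case False
    thus ?thesis unfolding eq using insert(2) by auto
  next
    case True
    hence "wedge (wedge_family \<theta> (insert b A)) (wedge_family \<theta> J) =
        fscale (inv_sign A J) (wedge (\<theta> b) (wedge_family \<theta> (A \<union> J)))"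
      unfolding eq insert(2) by (simp add: wedge_fscale_right)
    also have "\<dots> = (if b \<in> J then (\<lambda>_. 0)
        else fscale (inv_sign (insert b A) J) (wedge_family \<theta> (insert b A \<union> J)))"
    proof -
      \<comment> \<open>\<open>b\<close> is smaller than every element of \<open>A\<close>, so
        moving it into \<open>A \<union> J\<close> costs only the signs from
        \<open>J\<close>.\<close>
      have "inv_sign {b} A = 1" by (rule inv_sign_eq_1) (use insert(1) in \<open>auto simp: less_imp_le\<close>)
      hence "inv_sign {b} (A \<union> J) = inv_sign {b} J" using True by (simp add: inv_sign_Un_right)
      hence "inv_sign A J * inv_sign {b} (A \<union> J) = inv_sign (insert b A) J"
        using bA by (simp add: inv_sign_insert_left[of b A J] mult.commute)
      thus ?thesis using bA
        by (simp add: wedge_one_form_family[of \<theta> b "A \<union> J", OF \<theta>] fscale_fscale)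
          (simp add: fscale_def)
    qed
    finally show ?thesis using True by auto
  qed
qed

subsection \<open>The action on differential forms\<close>

lemma ppartial_add: "ppartial i (f + h) = ppartial i f + ppartial i h"
  unfolding ppartial_def
  by (rule setsum_keys_plus_distrib) (simp_all add: algebra_simps single_add)

lemma ppartial_sum: "ppartial i (\<Sum>x\<in>A. f x) = (\<Sum>x\<in>A. ppartial i (f x))"
proof -
  have "ppartial i 0 = 0" by (simp add: ppartial_def)
  thus ?thesis by (induction A rule: infinite_finite_induct) (simp_all add: ppartial_add)
qed

lemma ppartial_linpol: "ppartial i (linpol c) = pconst (c $ i)"
proof -
  have "ppartial i (pconst a * pvar j) = (if j = i then pconst a else 0)" for a j
    by (cases "a = 0") (auto simp: ppartial_def pconst_def pvar_def mult_single lookup_single)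
  thus ?thesis by (simp add: linpol_def ppartial_sum)
qed

lemma dpol_linpol: "dpol (linpol c) I = (\<Sum>i\<in>UNIV. if I = {i} then pconst (c $ i) else 0)"
  unfolding dpol_def ppartial_linpol ..

lemma dpol_linpol_singleton [simp]: "dpol (linpol c) {i} = pconst (c $ i)"
  by (simp add: dpol_linpol)

lemma dpol_linpol_degree: "dpol (linpol c) \<in> forms_of_degree 1"
  by (auto simp: forms_of_degree_def dpol_linpol intro!: sum.neutral)

lemma act_dx_wedge_eq: "act_dx_wedge g = wedge_family (\<lambda>i. dpol (pact g (pvar i)))"
  by (simp add: fun_eq_iff act_dx_wedge_def wedge_family_def)

lemma dpol_pact_pvar_degree: "dpol (pact g (pvar i)) \<in> forms_of_degree 1"
  unfolding pact_pvar by (rule dpol_linpol_degree)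

lemma act_dx_wedge_degree: "act_dx_wedge g I \<in> forms_of_degree (card I)"
  unfolding act_dx_wedge_eq by (rule wedge_family_degree) (rule dpol_pact_pvar_degree)

lemma form_act_sum: "form_act g (\<lambda>I. \<Sum>x\<in>A. f x I) = (\<lambda>K. \<Sum>x\<in>A. form_act g (f x) K)"
  by (simp add: form_act_def fscale_def pact_sum sum_distrib_right) (intro ext sum.swap)

lemma form_act_fscale: "form_act g (fscale f \<omega>) = fscale (pact g f) (form_act g \<omega>)"
  by (simp add: form_act_def fscale_def pact_mult sum_distrib_left mult.assoc)

lemma form_act_indicator: "form_act g (\<lambda>K. if K = I then 1 else 0) = act_dx_wedge g I"
proof
  fix K
  have "form_act g (\<lambda>K. if K = I then 1 else 0) K =
      (\<Sum>J\<in>UNIV. if J = I then act_dx_wedge g J K else 0)"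
    unfolding form_act_def by (rule sum.cong) (auto simp: fscale_def)
  thus "form_act g (\<lambda>K. if K = I then 1 else 0) K = act_dx_wedge g I K" by simp
qed

lemma form_act_fone [simp]: "form_act g fone = fone"
  using form_act_indicator[of g "{}"] by (simp add: fone_def act_dx_wedge_eq)

text \<open>Expanding the right-hand side gives a sum over pairs \<open>I\<close>, \<open>J\<close>,
  in which only disjoint pairs survive by \<open>wedge_family_mult\<close>. Regrouping by the union
  \<open>K\<close> of the pair produces the coefficients of
  \<open>wedge \<mu> \<omega>\<close>.\<close>

lemma form_act_wedge: "form_act g (wedge \<mu> \<omega>) = wedge (form_act g \<mu>) (form_act g \<omega>)"
proof
  fix X
  let ?E = "act_dx_wedge g"
  have "wedge (form_act g \<mu>) (form_act g \<omega>) X =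
      (\<Sum>I\<in>UNIV. \<Sum>J\<in>UNIV. pact g (\<mu> I) * (pact g (\<omega> J) * wedge (?E I) (?E J) X))"
    by (simp only: form_act_def wedge_sum_left wedge_sum_right wedge_fscale_left wedge_fscale_right)
      (simp add: fscale_def sum_distrib_left mult.left_commute)
  also have "\<dots> = (\<Sum>I\<in>UNIV. \<Sum>J\<in>Pow (- I).
      inv_sign I J * pact g (\<mu> I) * pact g (\<omega> J) * ?E (I \<union> J) X)"
  proof (rule sum.cong[OF refl])
    fix I :: "'a set"
    have "wedge (?E I) (?E J) =
        (if I \<inter> J = {} then fscale (inv_sign I J) (?E (I \<union> J)) else (\<lambda>_. 0))" for J
      unfolding act_dx_wedge_eq by (rule wedge_family_mult) (rule dpol_pact_pvar_degree)
    thus "(\<Sum>J\<in>UNIV. pact g (\<mu> I) * (pact g (\<omega> J) * wedge (?E I) (?E J) X)) =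
        (\<Sum>J\<in>Pow (- I). inv_sign I J * pact g (\<mu> I) * pact g (\<omega> J) * ?E (I \<union> J) X)"
      by (intro sum.mono_neutral_cong_right) (auto simp: fscale_def mult_ac)
  qed
  also have "\<dots> = (\<Sum>(I, J)\<in>Sigma UNIV (\<lambda>I. Pow (- I)).
      inv_sign I J * pact g (\<mu> I) * pact g (\<omega> J) * ?E (I \<union> J) X)"
    by (simp add: sum.Sigma)
  also have "\<dots> = (\<Sum>(K, I)\<in>Sigma UNIV Pow.
      inv_sign I (K - I) * pact g (\<mu> I) * pact g (\<omega> (K - I)) * ?E K X)"
  proof (rule sum.reindex_bij_witness[of _ "\<lambda>(K, I). (I, K - I)" "\<lambda>(I, J). (I \<union> J, I)"])
    fix x :: "'a set \<times> 'a set" assume "x \<in> Sigma UNIV (\<lambda>I. Pow (- I))"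
    then obtain I J where x: "x = (I, J)" and e: "I \<union> J - I = J" by auto
    show "(case case x of (I, J) \<Rightarrow> (I \<union> J, I) of (K, I) \<Rightarrow>
        inv_sign I (K - I) * pact g (\<mu> I) * pact g (\<omega> (K - I)) * ?E K X) =
      (case x of (I, J) \<Rightarrow> inv_sign I J * pact g (\<mu> I) * pact g (\<omega> J) * ?E (I \<union> J) X)"
      unfolding x case_prod_conv e ..
  qed auto
  also have "\<dots> = (\<Sum>K\<in>UNIV. \<Sum>I\<in>Pow K.
      inv_sign I (K - I) * pact g (\<mu> I) * pact g (\<omega> (K - I)) * ?E K X)"
    by (simp add: sum.Sigma)
  also have "\<dots> = form_act g (wedge \<mu> \<omega>) X"
    by (simp add: form_act_def wedge_eq fscale_def pact_sum pact_mult sum_distrib_right mult.assoc)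
  finally show "form_act g (wedge \<mu> \<omega>) X = wedge (form_act g \<mu>) (form_act g \<omega>) X" ..
qed

text \<open>Both sides are linear in \<open>c\<close> and agree on the coordinates, where the action
  was defined by \<open>g dx_i = d(g x_i)\<close>. Hence composing actions on differentials reduces
  to composing them on linear forms.\<close>

lemma form_act_dpol_linpol: "form_act A (dpol (linpol c)) = dpol (pact A (linpol c))"
proof
  fix K
  have single: "act_dx_wedge A {i} = dpol (linpol (row i (matrix_inv A)))" for i
    using wedge_family_insert_min[of "{}" i] by (simp add: act_dx_wedge_eq pact_pvar)
  have "dpol (linpol c) = (\<lambda>I. \<Sum>i\<in>UNIV. fscale (pconst (c $ i)) (\<lambda>J. if J = {i} then 1 else 0) I)"
    by (auto simp: fun_eq_iff dpol_linpol fscale_def intro!: sum.cong)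
  hence "form_act A (dpol (linpol c)) K =
      (\<Sum>i\<in>UNIV. pconst (c $ i) * dpol (linpol (row i (matrix_inv A))) K)"
    by (simp add: form_act_sum form_act_fscale form_act_indicator single) (simp add: fscale_def)
  also have "\<dots> = dpol (linpol (c v* matrix_inv A)) K"
  proof (cases "\<exists>j. K = {j}")
    case True
    thus ?thesis
      by (auto simp: row_def vector_matrix_mult_def pconst_sum pconst_mult mult.commute)
  next
    case False
    hence "card K \<noteq> 1" by (auto simp: card_1_singleton_iff)
    hence "dpol (linpol d) K = 0" for d :: "'a cvec"
      using dpol_linpol_degree[of d] by (simp add: forms_of_degree_def)
    thus ?thesis by simp
  qed
  finally show "form_act A (dpol (linpol c)) K = dpol (pact A (linpol c)) K"
    by (simp add: pact_linpol)
qed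

lemma form_act_act_dx_wedge:
  assumes "invertible A" "invertible B"
  shows "form_act A (act_dx_wedge B I) = act_dx_wedge (A ** B) I"
proof -
  have "form_act A (foldr (\<lambda>i. wedge (dpol (pact B (pvar i)))) xs fone) =
      foldr (\<lambda>i. wedge (dpol (pact (A ** B) (pvar i)))) xs fone" for xs
  proof (induction xs)
    case (Cons i xs)
    have "form_act A (dpol (pact B (pvar i))) = dpol (pact A (pact B (pvar i)))"
      unfolding pact_pvar[of B] by (rule form_act_dpol_linpol)
    thus ?case using Cons assms by (simp add: form_act_wedge pact_pact)
  qed simp
  thus ?thesis by (simp add: act_dx_wedge_def)
qed

text \<open>Stated for invertible rather than unitary matrices, because the action also serves for
  changes of coordinates, whose matrices may lie outside the unitary group.\<close>

lemma form_act_form_act: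
  assumes "invertible A" "invertible B"
  shows "form_act A (form_act B \<omega>) = form_act (A ** B) \<omega>"
  using assms
  by (simp add: form_act_def[of B] form_act_def[of "A ** B"] form_act_sum form_act_fscale
      pact_pact form_act_act_dx_wedge)

lemma form_act_mat_1 [simp]: "form_act (mat 1) \<omega> = \<omega>"
proof
  fix K
  have "act_dx_wedge (mat 1) I = (\<lambda>K. if K = I then 1 else 0)" for I :: "'a set"
    using dx_wedge_eq[of I] by (simp add: act_dx_wedge_def dx_wedge_def)
  thus "form_act (mat 1) \<omega> K = \<omega> K"
    by (simp add: form_act_def fscale_def if_distrib[of "\<lambda>x. _ * x"] cong: if_cong)
qed

section \<open>Homogeneous parts and coefficients avoiding an index\<close>

lemma form_act_homogeneous_part:
  "form_act g (\<lambda>I. if card I = p then \<omega> I else 0) = (\<lambda>I. if card I = p then form_act g \<omega> I else 0)"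
proof
  fix K
  have "pact g (if card I = p then \<omega> I else 0) * act_dx_wedge g I K =
      (if card K = p then pact g (\<omega> I) * act_dx_wedge g I K else 0)" for I
    using act_dx_wedge_degree[of g I] by (auto simp: forms_of_degree_def)
  thus "form_act g (\<lambda>I. if card I = p then \<omega> I else 0) K =
      (if card K = p then form_act g \<omega> K else 0)"
    by (simp add: form_act_def fscale_def)
qed

text \<open>The action preserves degrees, so the homogeneous parts of a form satisfying the
  eigenvector equation satisfy it as well. Invariance can thus be treated without reference to the
  grading.\<close>

lemma chi_forms_iff:
  "\<omega> \<in> chi_forms G \<psi> \<longleftrightarrow> (\<forall>g\<in>G. form_act g \<omega> = fscale (pconst (\<psi> g)) \<omega>)"
proof
  assume "\<omega> \<in> chi_forms G \<psi>"
  then obtain \<eta> where "\<forall>p. \<eta> p \<in> chi_forms_of_degree G \<psi> p" "\<omega> = (\<lambda>I. \<Sum>p\<le>CARD('a). \<eta> p I)"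
    by (auto simp: chi_forms_def)
  thus "\<forall>g\<in>G. form_act g \<omega> = fscale (pconst (\<psi> g)) \<omega>"
    by (simp add: chi_forms_of_degree_def form_act_sum) (simp add: fscale_def sum_distrib_left)
next
  assume inv: "\<forall>g\<in>G. form_act g \<omega> = fscale (pconst (\<psi> g)) \<omega>"
  define \<eta> where "\<eta> p = (\<lambda>I. if card I = p then \<omega> I else 0)" for p
  have "\<eta> p \<in> chi_forms_of_degree G \<psi> p" for p
    using inv by (auto simp: chi_forms_of_degree_def forms_of_degree_def \<eta>_def
        form_act_homogeneous_part fscale_def fun_eq_iff)
  moreover have "\<omega> = (\<lambda>I. \<Sum>p\<le>CARD('a). \<eta> p I)"
    by (simp add: \<eta>_def fun_eq_iff card_mono)
  ultimately show "\<omega> \<in> chi_forms G \<psi>" unfolding chi_forms_def by blast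
qed

text \<open>If the inverse of \<open>g\<close> differs from the identity only in column
  \<open>k\<close>, then \<open>g dx_i\<close> and \<open>dx_i\<close> agree modulo
  \<open>dx_k\<close>, and coefficients at index sets without \<open>k\<close> do not see
  \<open>dx_k\<close>.\<close>

lemma act_dx_wedge_avoiding:
  assumes "\<And>i j. j \<noteq> k \<Longrightarrow> matrix_inv g $ i $ j = mat 1 $ i $ j"
    and "k \<notin> K"
  shows "act_dx_wedge g I K = (if K = I then 1 else 0)"
proof -
  have \<theta>: "dpol (pact g (pvar i)) L = dpol (pvar i) L" if "L \<subseteq> K" for i L
  proof (cases "\<exists>j. L = {j}")
    case True
    then obtain j where L: "L = {j}" by blast
    with that assms(2) have "j \<noteq> k" by auto
    with assms(1) show ?thesis
      by (auto simp: L pact_pvar dpol_pvar row_def mat_def)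
  next
    case False
    hence "card L \<noteq> 1" by (auto simp: card_1_singleton_iff)
    thus ?thesis using False dpol_pact_pvar_degree[of g i]
      by (auto simp: forms_of_degree_def dpol_pvar)
  qed
  have "foldr (\<lambda>i. wedge (dpol (pact g (pvar i)))) xs fone L =
      foldr (\<lambda>i. wedge (dpol (pvar i))) xs fone L" if "L \<subseteq> K" for xs L
    using that
  proof (induction xs arbitrary: L)
    case (Cons i xs)
    show ?case unfolding foldr.simps o_apply
      by (rule wedge_cong) (use Cons \<theta> in auto)
  qed simp
  thus ?thesis using dx_wedge_eq[of I]
    by (simp add: act_dx_wedge_def dx_wedge_def)
qed

lemma form_act_avoiding:
  assumes "\<And>i j. j \<noteq> k \<Longrightarrow> matrix_inv g $ i $ j = mat 1 $ i $ j"
    and "k \<notin> K"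
  shows "form_act g \<omega> K = pact g (\<omega> K)"
  by (simp add: form_act_def fscale_def act_dx_wedge_avoiding[OF assms]
      if_distrib[of "\<lambda>x. _ * x"] cong: if_cong)

subsection \<open>Matrices fixing a hyperplane pointwise\<close>

lemma dotp_eqI:
  assumes "\<And>v. dotp c v = dotp d v"
  shows "c = d"
  using assms[of "axis _ 1"] by (simp add: vec_eq_iff)

lemma dotp_vector_matrix: "dotp (c v* A) v = dotp c (A *v v)"
proof -
  have "dotp (c v* A) v = (\<Sum>j\<in>UNIV. \<Sum>i\<in>UNIV. c $ i * A $ i $ j * v $ j)"
    by (simp add: dotp_def vector_matrix_mult_def sum_distrib_right mult.commute[of "A $ _ $ _"])
  also have "\<dots> = (\<Sum>i\<in>UNIV. \<Sum>j\<in>UNIV. c $ i * A $ i $ j * v $ j)"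
    by (rule sum.swap)
  finally show ?thesis
    by (simp add: dotp_def matrix_vector_mult_def sum_distrib_left mult.assoc)
qed

lemma matrix_inv_vector:
  fixes A :: "'n::finite cmat"
  assumes "invertible A"
  shows "matrix_inv A *v (A *v v) = v" "A *v (matrix_inv A *v v) = v"
  using assms by (simp_all add: matrix_vector_mul_assoc matrix_inv_inverse)

text \<open>The map \<open>g - 1\<close> vanishes on the kernel of \<open>c\<close> and so factors
  through \<open>dotp c\<close>. The vector \<open>w\<close> is its value at \<open>axis k 1\<close>
  divided by \<open>c $ k\<close>, a point where \<open>dotp c\<close> is 1.\<close>

lemma rank_one_if_fixes_kernel:
  fixes g :: "'n::finite cmat"
  assumes "c \<noteq> 0" "\<And>v. dotp c v = 0 \<Longrightarrow> g *v v = v"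
  obtains w where "\<And>v. g *v v = v + dotp c v *s w"
proof -
  from assms(1) obtain k where k: "c $ k \<noteq> 0" by (auto simp: vec_eq_iff)
  define w where "w = (1 / c $ k) *s (g *v axis k 1 - axis k 1)"
  have "g *v v = v + dotp c v *s w" for v
  proof -
    define a where "a = dotp c v / c $ k"
    have "dotp c (v - a *s axis k 1) = 0"
      using k by (simp add: dotp_simps a_def)
    hence "g *v (v - a *s axis k 1) = v - a *s axis k 1" by (rule assms(2))
    hence "g *v v - a *s (g *v axis k 1) = v - a *s axis k 1"
      by (simp only: matrix_vector_mult_diff_distrib vector_scalar_commute)
    hence "g *v v = v - a *s axis k 1 + a *s (g *v axis k 1)"
      by (simp only: diff_eq_eq)
    moreover have "dotp c v *s w = a *s (g *v axis k 1) - a *s axis k 1"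
      by (simp add: w_def a_def vec_eq_iff algebra_simps)
    ultimately show ?thesis by simp
  qed
  thus ?thesis by (rule that)
qed

text \<open>After transposition this is Cramer's rule for the identity matrix.\<close>

lemma det_replaced_row:
  "det (\<chi> i j. if i = k then c $ j else mat 1 $ i $ j :: 'n::finite cmat) = c $ k"
    (is "det ?M = _")
proof -
  have "transpose ?M = (\<chi> i j. if j = k then (mat 1 *v c) $ i else mat 1 $ i $ j)"
    unfolding matrix_vector_mul_lid by (simp add: transpose_def vec_eq_iff mat_def)
  hence "det (transpose ?M) = c $ k * det (mat 1 :: 'n cmat)"
    by (simp only: cramer_lemma)
  thus ?thesis by (simp add: det_transpose)
qed

text \<open>The matrix determinant lemma. \<open>M\<close> turns \<open>dotp c\<close> into the
  coordinate \<open>k\<close> and conjugates \<open>g\<close> into \<open>D\<close>, an identity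
  matrix with column \<open>k\<close> replaced, whose determinant is its diagonal entry
  there.\<close>

lemma det_rank_one:
  fixes g :: "'n::finite cmat"
  assumes "c \<noteq> 0" and g: "\<And>v. g *v v = v + dotp c v *s w"
  shows "det g = 1 + dotp c w"
proof -
  from assms(1) obtain k where k: "c $ k \<noteq> 0" by (auto simp: vec_eq_iff)
  define M :: "'n cmat" where "M = (\<chi> i j. if i = k then c $ j else mat 1 $ i $ j)"
  \<comment> \<open>\<open>z\<close> is \<open>M *v w + axis k 1\<close>, the image of
    \<open>axis k 1\<close> under the conjugated matrix.\<close>
  define z where "z = (\<chi> i. if i = k then 1 + dotp c w else w $ i)"
  define D :: "'n cmat" where "D = (\<chi> i j. if j = k then (mat 1 *v z) $ i else mat 1 $ i $ j)"
  have M_vec: "M *v v = (\<chi> i. if i = k then dotp c v else v $ i)" for v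
    by (simp add: vec_eq_iff M_def matrix_vector_mult_def dotp_def mat_def
        if_distrib[of "\<lambda>x. x * _"] cong: if_cong)
  have D_vec: "D *v v = (\<chi> i. (if i = k then 0 else v $ i) + v $ k * z $ i)" for v
  proof -
    have "(\<Sum>j\<in>UNIV. D $ i $ j * v $ j) = (\<Sum>j\<in>UNIV. (if j = k then v $ k * z $ i else 0) +
        (if j = i then if i = k then 0 else v $ i else 0))" for i
      unfolding D_def matrix_vector_mul_lid by (rule sum.cong) (auto simp: mat_def)
    thus ?thesis by (simp add: vec_eq_iff matrix_vector_mult_def sum.distrib)
  qed
  have "M ** g = D ** M"
    unfolding matrix_eq
    by (simp add: M_vec D_vec g dotp_simps z_def vec_eq_iff algebra_simps flip: matrix_vector_mul_assoc)
  hence "det M * det g = det D * det M" by (simp flip: det_mul)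
  moreover have "det D = 1 + dotp c w"
    unfolding D_def using cramer_lemma[of k "mat 1" z] by (simp add: z_def)
  moreover have "det M = c $ k"
    unfolding M_def by (rule det_replaced_row)
  ultimately show ?thesis using k by simp
qed

lemma dotp_fixing_kernel:
  fixes g :: "'n::finite cmat"
  assumes "c \<noteq> 0" "\<And>v. dotp c v = 0 \<Longrightarrow> g *v v = v"
  shows "dotp c (g *v v) = det g * dotp c v"
proof -
  obtain w where "\<And>v. g *v v = v + dotp c v *s w"
    using rank_one_if_fixes_kernel[OF assms] by blast
  with det_rank_one[OF assms(1) this] show ?thesis by (simp add: dotp_simps algebra_simps)
qed

lemma unitary_group_simps [simp]:
  "A \<otimes>\<^bsub>unitary_group\<^esub> B = A ** B" "\<one>\<^bsub>unitary_group\<^esub> = mat 1"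
  "A \<in> carrier unitary_group \<longleftrightarrow> unitary_matrix A"
  by (simp_all add: unitary_group_def)

lemma unitary_group_pow_Suc: "g [^]\<^bsub>unitary_group\<^esub> Suc n = g [^]\<^bsub>unitary_group\<^esub> n ** g"
  by (simp add: nat_pow_def)

lemma invertible_unitary: "unitary_matrix A \<Longrightarrow> invertible A"
  by (auto simp: unitary_matrix_def invertible_def)

lemma inv_unitary_group:
  assumes "unitary_matrix A"
  shows "inv\<^bsub>unitary_group\<^esub> A = matrix_inv A"
proof -
  have "matrix_inv A = conj_transpose A"
    using assms by (intro matrix_inv_unique) (simp add: unitary_matrix_def)
  moreover have "inv\<^bsub>unitary_group\<^esub> A = conj_transpose A"
    using assms by (intro group.inv_equality[OF group_unitary_group])
      (auto simp: unitary_matrix_def conj_transpose_involution)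
  ultimately show ?thesis by simp
qed

text \<open>Determinant 1 means \<open>dotp c w = 0\<close>, so \<open>g\<close> is a transvection
  or the identity. The powers of a transvection move \<open>v\<close> by growing multiples of
  \<open>dotp c v *s w\<close>, which finite order rules out in characteristic 0.\<close>

lemma eq_1_if_det_eq_1:
  fixes g :: "'n::finite cmat"
  assumes c: "c \<noteq> 0" and fixes_kernel: "\<And>v. dotp c v = 0 \<Longrightarrow> g *v v = v"
    and "det g = 1" and "g [^]\<^bsub>unitary_group\<^esub> m = mat 1" "m > (0::nat)"
  shows "g = mat 1"
proof -
  obtain w where g: "\<And>v. g *v v = v + dotp c v *s w"
    using rank_one_if_fixes_kernel[OF assms(1,2)] by blast
  with det_rank_one[OF c g] assms(3) have w: "dotp c w = 0" by simp
  have "(g [^]\<^bsub>unitary_group\<^esub> n) *v v = v + (of_nat n * dotp c v) *s w" for n :: nat and v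
  proof (induction n arbitrary: v)
    case 0
    show ?case by simp
  next
    case (Suc n)
    show ?case
      by (simp add: unitary_group_pow_Suc Suc g dotp_simps w algebra_simps vec_eq_iff flip: matrix_vector_mul_assoc)
  qed
  from this[of m] assms(4,5) have "dotp c v *s w = 0" for v
    by (auto simp: vec_eq_iff)
  hence "\<forall>v. g *v v = mat 1 *v v" by (simp add: g)
  thus ?thesis unfolding matrix_eq .
qed

section \<open>Action modulo the linear form of a fixed hyperplane\<close>

lemma linpol_dvd_if_kernel_subset:
  assumes "\<And>v. dotp c v = 0 \<Longrightarrow> dotp d v = 0"
  shows "linpol c dvd linpol d"
proof -
  obtain k where "d = k *s c" using proportional_if_kernel_subset[OF assms] by blast
  thus ?thesis by (simp add: linpol_scale)
qed

text \<open>The inverse of \<open>g\<close> also fixes the kernel of \<open>c\<close> pointwise.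
  Hence each image of a variable differs from that variable by a linear form vanishing on this
  kernel, which is a multiple of \<open>linpol c\<close>.\<close>

lemma dvd_pact_diff:
  assumes "invertible g" "\<And>v. dotp c v = 0 \<Longrightarrow> g *v v = v"
  shows "linpol c dvd pact g f - f"
proof -
  have "linpol c dvd psubst (\<lambda>i. linpol (row i (matrix_inv g))) f - psubst pvar f"
  proof (rule psubst_cong_dvd)
    fix i
    have "dotp (row i (matrix_inv g) - axis i 1) v = 0" if "dotp c v = 0" for v
    proof -
      have "matrix_inv g *v v = v"
        using matrix_inv_vector(1)[OF assms(1), of v] assms(2)[OF that] by simp
      moreover have "(matrix_inv g *v v) $ i = dotp (row i (matrix_inv g)) v"
        by (simp add: matrix_vector_mult_def dotp_def row_def)
      moreover have "dotp (a - b) v = dotp a v - dotp b v" for a b :: "'a cvec"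
        by (simp add: dotp_def algebra_simps sum_subtractf)
      moreover have "dotp (axis i 1) v = v $ i" by simp
      ultimately show ?thesis by simp
    qed
    hence "linpol c dvd linpol (row i (matrix_inv g) - axis i 1)"
      by (rule linpol_dvd_if_kernel_subset)
    thus "linpol c dvd linpol (row i (matrix_inv g)) - pvar i" by (simp add: linpol_diff)
  qed
  thus ?thesis by (simp add: psubst_pvar_id pact_psubst)
qed

text \<open>\<open>g\<close> scales \<open>dotp c\<close> by its determinant; the reciprocal appears
  because polynomials transform through the inverse of \<open>g\<close>.\<close>

lemma pact_linpol_fixing_kernel:
  assumes "invertible g" "c \<noteq> 0" "\<And>v. dotp c v = 0 \<Longrightarrow> g *v v = v"
  shows "pact g (linpol c) = pconst (1 / det g) * linpol c"
proof -
  have nz: "det g \<noteq> 0" using assms(1) by (simp add: invertible_det_nz)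
  have "c v* matrix_inv g = (1 / det g) *s c"
  proof (rule dotp_eqI)
    fix v
    have "dotp c (g *v (matrix_inv g *v v)) = det g * dotp c (matrix_inv g *v v)"
      using assms(2,3) by (rule dotp_fixing_kernel)
    hence "dotp c v = det g * dotp c (matrix_inv g *v v)"
      unfolding matrix_inv_vector(2)[OF assms(1)] .
    hence "dotp c (matrix_inv g *v v) = dotp c v / det g"
      using nz by (metis nonzero_mult_div_cancel_left)
    thus "dotp (c v* matrix_inv g) v = dotp ((1 / det g) *s c) v"
      by (simp add: dotp_vector_matrix) (simp add: dotp_def sum_divide_distrib)
  qed
  thus ?thesis by (simp add: pact_linpol linpol_scale)
qed

text \<open>
  If \<open>\<alpha>\<^sup>k\<close> divides \<open>f\<close>, then the cofactor is an eigenvector of \<open>g\<close> whose eigenvalue is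
  not 1 as long as \<open>\<psi> g \<noteq> (det g)\<^sup>-\<^sup>k\<close>; since \<open>g\<close> acts trivially modulo \<open>\<alpha>\<close>,
  a further factor \<open>\<alpha>\<close> splits off.
\<close>

lemma power_dvd_if_semi_invariant:
  fixes p :: "'n::{finite,linorder} pol"
  assumes "p \<noteq> 0" and p: "pact g p = pconst (1 / d) * p" and "d \<noteq> 0"
    and dvd: "\<And>f. p dvd pact g f - f"
    and f: "pact g f = pconst z * f"
    and least: "\<And>b. b < a \<Longrightarrow> z * d ^ b \<noteq> 1"
  shows "p ^ a dvd f"
proof -
  have "p ^ b dvd f" if "b \<le> a" for b
    using that
  proof (induction b)
    case (Suc b)
    then obtain h where h: "f = p ^ b * h" by auto
    have "pconst ((1 / d) ^ b) * (p ^ b * pact g h) = pconst z * (p ^ b * h)"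
      using f unfolding h by (simp add: pact_mult pact_power p power_mult_distrib pconst_power mult_ac)
    hence "p ^ b * (pconst ((1 / d) ^ b) * pact g h) = p ^ b * (pconst z * h)"
      by (simp add: mult_ac)
    hence "pconst ((1 / d) ^ b) * pact g h = pconst z * h"
      using assms(1) by (metis mult_cancel_left power_not_zero)
    hence "pconst (d ^ b) * (pconst ((1 / d) ^ b) * pact g h) = pconst (d ^ b) * (pconst z * h)"
      by simp
    hence "pconst (d ^ b * (1 / d) ^ b) * pact g h = pconst (z * d ^ b) * h"
      by (simp only: pconst_mult mult_ac)
    hence "pact g h = pconst (z * d ^ b) * h"
      using assms(3) by (simp flip: power_mult_distrib)
    hence "pact g h - h = pconst (z * d ^ b - 1) * h"
      by (simp add: pconst_diff algebra_simps)
    moreover have "z * d ^ b - 1 \<noteq> 0" using least[of b] Suc.prems by simp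
    ultimately have "p dvd h" using dvd[of h] by (simp add: dvd_pconst_mult_iff)
    thus ?case by (simp add: h mult_dvd_mono mult.commute[of p])
  qed simp
  thus ?thesis by simp
qed

subsection \<open>Divisibility of wedge products\<close>

text \<open>The local divisibility, phrased for one matrix \<open>g\<close> and one eigenvalue
  \<open>z\<close>. It is applied with \<open>g = s H\<close>, \<open>z = \<psi> (s H)\<close> and
  \<open>a\<close> the exponent of \<open>H\<close>, whose minimality supplies
  \<open>least\<close>.\<close>

lemma power_dvd_wedge:
  fixes c :: "'n::{finite,linorder} cvec"
  assumes g: "invertible g" and c: "c \<noteq> 0" and fixes_kernel: "\<And>v. dotp c v = 0 \<Longrightarrow> g *v v = v"
    and \<mu>: "form_act g \<mu> = fscale (pconst z) \<mu>" and \<omega>: "form_act g \<omega> = fscale (pconst z) \<omega>"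
    and least: "\<And>b. b < a \<Longrightarrow> z * det g ^ b \<noteq> 1"
  shows "linpol c ^ a dvd wedge \<mu> \<omega> K"
proof -
  from c obtain k where k: "c $ k \<noteq> 0" by (auto simp: vec_eq_iff)
  \<comment> \<open>Change coordinates so that the linear form becomes the coordinate \<open>pvar k\<close>; then \<open>g\<close>
    becomes \<open>D\<close>, which changes only the \<open>k\<close>-th column of the identity matrix.\<close>
  define M :: "'n cmat" where "M = (\<chi> i j. if i = k then c $ j else mat 1 $ i $ j)"
  have M_vec: "(M *v v) $ k = dotp c v" for v
    by (simp add: M_def matrix_vector_mult_def dotp_def)
  have "det M = c $ k"
    unfolding M_def by (rule det_replaced_row)
  hence M: "invertible M" using k by (simp add: invertible_det_nz)
  define P where "P = matrix_inv M"
  have MP: "M ** P = mat 1" "P ** M = mat 1"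
    using matrix_inv_inverse[OF M] by (simp_all add: P_def)
  hence P: "invertible P" by (auto simp: invertible_def)
  define D where "D = M ** g ** P"
  have D: "invertible D" unfolding D_def using g M P by (intro invertible_mult)
  have "det M * det P = 1" using MP(1) by (metis det_I det_mul)
  hence det_D: "det D = det g" by (simp add: D_def det_mul)
  have D_fixes: "D *v v = v" if "dotp (axis k 1) v = 0" for v
  proof -
    have "dotp c (P *v v) = (M *v (P *v v)) $ k" by (simp add: M_vec)
    also have "\<dots> = 0" using that MP(1) by (simp add: matrix_vector_mul_assoc)
    finally have "g *v (P *v v) = P *v v" by (rule fixes_kernel)
    hence "D *v v = (M ** P) *v v" by (simp add: D_def flip: matrix_vector_mul_assoc)
    thus ?thesis using MP(1) by simp
  qed
  have ax: "axis k 1 \<noteq> (0 :: 'n cvec)" by (simp add: axis_eq_0_iff)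
  \<comment> \<open>The action on forms reads the entries of the inverse, so the statement about
    columns has to be passed from \<open>D\<close> to its inverse.\<close>
  have D_inv: "matrix_inv D $ i $ j = mat 1 $ i $ j" if "j \<noteq> k" for i j
  proof -
    have "D *v axis j 1 = axis j 1" using that by (intro D_fixes) (simp, simp add: axis_def)
    hence "matrix_inv D *v axis j 1 = axis j 1"
      using matrix_inv_vector(1)[OF D, of "axis j 1"] by simp
    moreover have "(A *v axis j 1) $ i = A $ i $ j" for A :: "'n cmat"
      by (simp add: matrix_vector_mult_def axis_def if_distrib[of "\<lambda>x. _ * x"] cong: if_cong)
    ultimately show ?thesis by (metis matrix_vector_mul_lid)
  qed
  have semi_inv: "pvar k ^ a dvd form_act M \<eta> I"
    if \<eta>: "form_act g \<eta> = fscale (pconst z) \<eta>" and "k \<notin> I" for \<eta> I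
  proof (rule power_dvd_if_semi_invariant)
    have "form_act D (form_act M \<eta>) = form_act M (form_act g \<eta>)"
      using M P D g by (simp add: form_act_form_act D_def MP(2) flip: matrix_mul_assoc)
    hence "form_act D (form_act M \<eta>) I = pconst z * form_act M \<eta> I"
      unfolding \<eta> form_act_fscale by (simp add: fscale_def)
    thus "pact D (form_act M \<eta> I) = pconst z * form_act M \<eta> I"
      using form_act_avoiding[OF D_inv \<open>k \<notin> I\<close>] by simp
    show "pvar k \<noteq> (0 :: 'n pol)"
      using prime_elem_linpol[OF ax] by (auto simp: prime_elem_def)
    show "pact D (pvar k) = pconst (1 / det D) * pvar k"
      using pact_linpol_fixing_kernel[OF D ax D_fixes] by simp
    show "det D \<noteq> 0" using D by (simp add: invertible_det_nz)
    show "pvar k dvd pact D f - f" for f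
      using dvd_pact_diff[of D "axis k 1", OF D D_fixes] by simp
    show "z * det D ^ b \<noteq> 1" if "b < a" for b
      using least[OF that] by (simp add: det_D)
  qed
  have "pvar k ^ a dvd wedge (form_act M \<mu>) (form_act M \<omega>) L" for L
    unfolding wedge_eq
  proof (rule dvd_sum, rule dvd_mult)
    fix I
    show "pvar k ^ a dvd form_act M \<mu> I * form_act M \<omega> (L - I)"
    proof (cases "k \<in> I")
      case True
      hence "k \<notin> L - I" by simp
      from semi_inv[OF \<omega> this] show ?thesis by (rule dvd_mult)
    next
      case False
      from semi_inv[OF \<mu> this] show ?thesis by (rule dvd_mult2)
    qed
  qed
  hence "\<forall>L. \<exists>f. form_act M (wedge \<mu> \<omega>) L = pvar k ^ a * f"
    by (auto simp: form_act_wedge dvd_def)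
  then obtain \<eta> where "\<And>L. form_act M (wedge \<mu> \<omega>) L = pvar k ^ a * \<eta> L" by metis
  hence "form_act M (wedge \<mu> \<omega>) = fscale (pvar k ^ a) \<eta>" by (simp add: fscale_def fun_eq_iff)
  \<comment> \<open>Applying \<open>P\<close> returns to the original coordinates and takes
    \<open>pvar k\<close> back to \<open>linpol c\<close>.\<close>
  hence "form_act P (form_act M (wedge \<mu> \<omega>)) = fscale (pact P (pvar k) ^ a) (form_act P \<eta>)"
    by (simp add: form_act_fscale pact_power)
  moreover have "pact P (pvar k) = linpol c"
  proof -
    have "matrix_inv P = M" using MP(2) by (rule matrix_inv_unique)
    thus ?thesis by (simp add: pact_pvar M_def row_def)
  qed
  ultimately have "wedge \<mu> \<omega> = fscale (linpol c ^ a) (form_act P \<eta>)"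
    using M P MP by (simp add: form_act_form_act)
  thus ?thesis by (simp add: fscale_def)
qed

subsection \<open>Reflection groups and the exponents\<close>

text \<open>The setting of the theorem, with each linear form given by its coefficient vector
  \<open>c H\<close>, so that \<open>\<alpha> H\<close> becomes \<open>linpol (c H)\<close>.\<close>

locale reflection_group =
  fixes G :: "'n::{finite,linorder} cmat set"
    and \<psi> :: "'n cmat \<Rightarrow> complex"
    and c :: "'n cvec set \<Rightarrow> 'n cvec"
    and s :: "'n cvec set \<Rightarrow> 'n cmat"
  assumes finite_group: "finite G"
    and subgroup: "subgroup G unitary_group"
    and generated: "generate unitary_group {g \<in> G. reflection g} = G"
    and character: "mult_character G \<psi>"
    and kernel: "H \<in> reflecting_hyperplanes G \<Longrightarrow> {v. dotp (c H) v = 0} = H"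
    and s_in_stabilizer: "H \<in> reflecting_hyperplanes G \<Longrightarrow> s H \<in> pointwise_stabilizer G H"
    and s_generates: "H \<in> reflecting_hyperplanes G \<Longrightarrow>
      generate unitary_group {s H} = pointwise_stabilizer G H"
begin

abbreviation \<A> where "\<A> \<equiv> reflecting_hyperplanes G"

lemma unitary: "g \<in> G \<Longrightarrow> unitary_matrix g"
  using subgroup.mem_carrier[OF subgroup] by simp

lemma invertible: "g \<in> G \<Longrightarrow> invertible g"
  by (simp add: unitary invertible_unitary)

lemma det_nonzero: "g \<in> G \<Longrightarrow> det g \<noteq> 0"
  using invertible by (simp add: invertible_det_nz)

lemma one_closed: "mat 1 \<in> G"
  using subgroup.one_closed[OF subgroup] by simp

lemma mult_closed: "g \<in> G \<Longrightarrow> h \<in> G \<Longrightarrow> g ** h \<in> G"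
  using subgroup.m_closed[OF subgroup] by simp

lemma inv_closed: "g \<in> G \<Longrightarrow> matrix_inv g \<in> G"
  using subgroup.m_inv_closed[OF subgroup, of g] by (simp add: inv_unitary_group unitary)

lemma character_mult: "g \<in> G \<Longrightarrow> h \<in> G \<Longrightarrow> \<psi> (g ** h) = \<psi> g * \<psi> h"
  using character unfolding mult_character_def by (auto simp: complex_units_def dest: hom_mult)

lemma character_nonzero: "g \<in> G \<Longrightarrow> \<psi> g \<noteq> 0"
  using character unfolding mult_character_def by (auto simp: complex_units_def hom_def)

lemma character_1: "\<psi> (mat 1) = 1"
  using character_mult[OF one_closed one_closed] character_nonzero[OF one_closed] by simp

text \<open>The order of \<open>G\<close> is such an exponent. It is written as a successor because
  the \<open>m\<close>-th power is then the inverse of \<open>g\<close>.\<close>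

lemma finite_order:
  assumes "g \<in> G"
  obtains m where "g [^]\<^bsub>unitary_group\<^esub> Suc m = mat 1"
proof -
  interpret group "unitary_group\<lparr>carrier := G\<rparr>"
    using subgroup group_unitary_group by (rule subgroup.subgroup_is_group)
  have "order (unitary_group\<lparr>carrier := G\<rparr>) > 0"
    using finite_group by (simp add: order_gt_0_iff_finite)
  then obtain m where m: "order (unitary_group\<lparr>carrier := G\<rparr>) = Suc m"
    using gr0_implies_Suc by blast
  have "g [^]\<^bsub>unitary_group\<lparr>carrier := G\<rparr>\<^esub> order (unitary_group\<lparr>carrier := G\<rparr>) = mat 1"
    using pow_order_eq_1[of g] assms by simp
  hence "g [^]\<^bsub>unitary_group\<^esub> Suc m = mat 1" unfolding m by (simp add: nat_pow_def)
  thus ?thesis by (rule that)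
qed

lemma pow_induct:
  assumes "g \<in> G" "P (mat 1)" "P g"
    and mult: "\<And>x y. x \<in> G \<Longrightarrow> y \<in> G \<Longrightarrow> P x \<Longrightarrow> P y \<Longrightarrow> P (x ** y)"
  shows "g [^]\<^bsub>unitary_group\<^esub> (m::nat) \<in> G \<and> P (g [^]\<^bsub>unitary_group\<^esub> m)"
proof (induction m)
  case 0
  show ?case using assms(2) one_closed by simp
next
  case (Suc m)
  thus ?case using assms(1,3) mult mult_closed by (simp add: unitary_group_pow_Suc)
qed

text \<open>Inverses are powers, since \<open>G\<close> is finite, so they need no clause of their own.\<close>

lemma generate_induct:
  assumes "x \<in> generate unitary_group S" "S \<subseteq> G" "P (mat 1)" and incl: "\<And>x. x \<in> S \<Longrightarrow> P x"
    and mult: "\<And>x y. x \<in> G \<Longrightarrow> y \<in> G \<Longrightarrow> P x \<Longrightarrow> P y \<Longrightarrow> P (x ** y)"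
  shows "x \<in> G \<and> P x"
  using assms(1)
proof (induction rule: generate.induct)
  case one
  thus ?case using assms(3) one_closed by simp
next
  case (incl h)
  thus ?case using assms(2) assms(4) by auto
next
  case (inv h)
  hence h: "h \<in> G" "P h" using assms(2) assms(4) by auto
  obtain m where "h [^]\<^bsub>unitary_group\<^esub> Suc m = mat 1" using finite_order[OF h(1)] by blast
  moreover have hm: "h [^]\<^bsub>unitary_group\<^esub> m \<in> G \<and> P (h [^]\<^bsub>unitary_group\<^esub> m)"
    using h(1) assms(3) h(2) mult by (rule pow_induct)
  ultimately have "inv\<^bsub>unitary_group\<^esub> h = h [^]\<^bsub>unitary_group\<^esub> m"
    using h unitary by (intro group.inv_equality[OF group_unitary_group]) (simp_all add: unitary_group_pow_Suc)
  thus ?case using hm by simp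
next
  case (eng h1 h2)
  thus ?case using mult mult_closed by simp
qed

section \<open>Stabilizers of hyperplanes and the exponents\<close>

lemma stabilizer_group: "x \<in> pointwise_stabilizer G H \<Longrightarrow> x \<in> G"
  by (simp add: pointwise_stabilizer_def)

lemma s_in_group: "H \<in> \<A> \<Longrightarrow> s H \<in> G"
  using s_in_stabilizer stabilizer_group by blast

lemma stabilizer_fixes:
  "H \<in> \<A> \<Longrightarrow> x \<in> pointwise_stabilizer G H \<Longrightarrow> dotp (c H) v = 0 \<Longrightarrow> x *v v = v"
  using kernel[of H] by (auto simp: pointwise_stabilizer_def)

lemma s_fixes: "H \<in> \<A> \<Longrightarrow> dotp (c H) v = 0 \<Longrightarrow> s H *v v = v"
  using stabilizer_fixes s_in_stabilizer by blast

lemma coefficients_nonzero: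
  assumes "H \<in> \<A>"
  shows "c H \<noteq> 0"
proof
  assume "c H = 0"
  hence "H = UNIV" using kernel[OF assms] by (auto simp: dotp_def)
  moreover have "vec.dim H = CARD('n) - 1"
    using assms by (simp add: reflecting_hyperplanes_def hyperplane_def)
  ultimately show False using vec_dim_card[where 'a=complex and 'n='n]
    by (metis diff_less less_irrefl zero_less_card_finite zero_less_one)
qed

text \<open>A power of \<open>s H\<close> fixes \<open>H\<close> pointwise and has finite order, so
  it is the identity once its determinant is 1. Thus \<open>det (s H)\<close> has the same order as
  \<open>s H\<close>.\<close>

lemma det_s_primitive:
  assumes "H \<in> \<A>" "det (s H) ^ j = 1"
  shows "group.ord unitary_group (s H) dvd j"
proof -
  have "s H \<in> pointwise_stabilizer G H" using assms(1) by (rule s_in_stabilizer)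
  hence stab: "s H [^]\<^bsub>unitary_group\<^esub> j \<in> G \<and> (det (s H [^]\<^bsub>unitary_group\<^esub> j) = det (s H) ^ j \<and>
      (\<forall>v. dotp (c H) v = 0 \<longrightarrow> s H [^]\<^bsub>unitary_group\<^esub> j *v v = v))"
  proof (induction j)
    case 0
    show ?case by (simp add: one_closed)
  next
    case (Suc j)
    thus ?case using assms(1)
      by (simp add: unitary_group_pow_Suc mult_closed s_in_group det_mul s_fixes flip: matrix_vector_mul_assoc)
  qed
  obtain m where "(s H [^]\<^bsub>unitary_group\<^esub> j) [^]\<^bsub>unitary_group\<^esub> Suc m = mat 1"
    using stab[THEN conjunct1] by (rule finite_order)
  hence "s H [^]\<^bsub>unitary_group\<^esub> j = mat 1"
  proof (rule eq_1_if_det_eq_1[OF coefficients_nonzero[OF assms(1)], rotated 2])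
    show "det (s H [^]\<^bsub>unitary_group\<^esub> j) = 1" using stab assms(2) by simp
    show "s H [^]\<^bsub>unitary_group\<^esub> j *v v = v" if "dotp (c H) v = 0" for v
      using stab that by blast
  qed simp
  thus ?thesis
    using group.pow_eq_id[OF group_unitary_group, of "s H" j] assms(1) by (simp add: s_in_group unitary)
qed

lemma ord_s_pos:
  assumes "H \<in> \<A>"
  shows "group.ord unitary_group (s H) > 0" "det (s H) ^ group.ord unitary_group (s H) = 1"
    "\<psi> (s H) ^ group.ord unitary_group (s H) = 1"
proof -
  note sG = s_in_group[OF assms]
  obtain m where "s H [^]\<^bsub>unitary_group\<^esub> Suc m = mat 1" using finite_order[OF sG] by blast
  hence "group.ord unitary_group (s H) dvd Suc m"
    using group.pow_eq_id[OF group_unitary_group, of "s H" "Suc m"] sG by (simp add: unitary)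
  thus "group.ord unitary_group (s H) > 0" by (auto intro: Nat.gr0I)
  have "s H [^]\<^bsub>unitary_group\<^esub> j \<in> G \<and> det (s H [^]\<^bsub>unitary_group\<^esub> j) = det (s H) ^ j \<and>
      \<psi> (s H [^]\<^bsub>unitary_group\<^esub> j) = \<psi> (s H) ^ j" for j :: nat
  proof (induction j)
    case 0
    show ?case by (simp add: one_closed character_1)
  next
    case (Suc j)
    thus ?case using sG
      by (simp add: unitary_group_pow_Suc mult_closed det_mul character_mult)
  qed
  moreover have "s H [^]\<^bsub>unitary_group\<^esub> group.ord unitary_group (s H) = mat 1"
    using group.pow_ord_eq_1[OF group_unitary_group, of "s H"] sG by (simp add: unitary)
  ultimately show "det (s H) ^ group.ord unitary_group (s H) = 1"
      "\<psi> (s H) ^ group.ord unitary_group (s H) = 1"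
    by (metis det_I, metis character_1)
qed

text \<open>The powers of \<open>det (s H)\<close> with exponent below the order \<open>?o\<close>
  of \<open>s H\<close> are distinct, hence are all \<open>?o\<close> roots of unity of that order;
  the inverse of \<open>\<psi> (s H)\<close> is one of them.\<close>

lemma exponent_exists:
  assumes "H \<in> \<A>"
  shows "\<exists>a < group.ord unitary_group (s H). \<psi> (s H) * det (s H) ^ a = 1"
proof -
  let ?o = "group.ord unitary_group (s H)"
  let ?d = "det (s H)"
  have nz: "?d \<noteq> 0" using assms by (simp add: det_nonzero s_in_group)
  have inj: "inj_on (\<lambda>a. ?d ^ a) {..<?o}"
  proof (rule linorder_inj_onI)
    fix a b assume ab: "a < b" "a \<in> {..<?o}" "b \<in> {..<?o}"
    show "?d ^ a \<noteq> ?d ^ b"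
    proof
      assume "?d ^ a = ?d ^ b"
      hence "?d ^ (b - a) = 1" using ab(1) nz by (simp add: power_diff)
      hence "?o dvd b - a" by (rule det_s_primitive[OF assms])
      thus False using ab by (auto dest: dvd_imp_le)
    qed
  qed auto
  have "?d ^ a \<in> {z. z ^ ?o = 1}" for a
  proof -
    have "(?d ^ a) ^ ?o = (?d ^ ?o) ^ a" by (simp only: power_mult[symmetric] mult.commute)
    thus ?thesis using ord_s_pos(2)[OF assms] by simp
  qed
  hence "(\<lambda>a. ?d ^ a) ` {..<?o} = {z. z ^ ?o = 1}"
    using ord_s_pos(1)[OF assms] inj card_roots_unity_eq[of ?o]
    by (intro card_subset_eq finite_roots_unity) (auto simp: card_image)
  moreover have "inverse (\<psi> (s H)) \<in> {z. z ^ ?o = 1}"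
    using ord_s_pos(3)[OF assms] by (simp add: power_inverse)
  ultimately obtain a where "a < ?o" "inverse (\<psi> (s H)) = ?d ^ a" by (auto simp: image_iff)
  moreover have "\<psi> (s H) \<noteq> 0" using assms by (simp add: character_nonzero s_in_group)
  ultimately show ?thesis by (metis right_inverse)
qed

text \<open>Both \<open>\<psi>\<close> and \<open>det\<close> are multiplicative, so the condition
  spreads from a generator to its group. The right-hand side is independent of the chosen
  generator.\<close>

lemma exponent_iff:
  assumes "H \<in> \<A>"
  shows "\<psi> (s H) * det (s H) ^ a = 1 \<longleftrightarrow> (\<forall>x\<in>pointwise_stabilizer G H. \<psi> x * det x ^ a = 1)"
proof
  assume *: "\<psi> (s H) * det (s H) ^ a = 1"
  show "\<forall>x\<in>pointwise_stabilizer G H. \<psi> x * det x ^ a = 1"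
  proof
    fix x assume "x \<in> pointwise_stabilizer G H"
    hence "x \<in> generate unitary_group {s H}" using s_generates[OF assms] by simp
    hence "x \<in> G \<and> \<psi> x * det x ^ a = 1"
    proof (rule generate_induct)
      show "\<psi> (x ** y) * det (x ** y) ^ a = 1"
        if "x \<in> G" "y \<in> G" "\<psi> x * det x ^ a = 1" "\<psi> y * det y ^ a = 1" for x y
      proof -
        have "\<psi> (x ** y) * det (x ** y) ^ a = (\<psi> x * det x ^ a) * (\<psi> y * det y ^ a)"
          using that(1,2) by (simp add: character_mult det_mul power_mult_distrib)
        thus ?thesis using that(3,4) by simp
      qed
    qed (use * assms in \<open>auto simp: character_1 s_in_group\<close>)
    thus "\<psi> x * det x ^ a = 1" ..
  qed
qed (use s_in_stabilizer[OF assms] in blast)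

text \<open>Some solution lies below the order of \<open>s H\<close>, hence so does the least one.
  The resulting description mentions only the stabilizer and can be compared along orbits of
  \<open>G\<close>.\<close>

lemma chi_exponent_eq:
  assumes "H \<in> \<A>"
  shows "chi_exponent \<psi> (s H) = (LEAST a. \<forall>x\<in>pointwise_stabilizer G H. \<psi> x * det x ^ a = 1)"
proof -
  have "det (s H) \<noteq> 0" using assms by (simp add: det_nonzero s_in_group)
  hence "\<psi> (s H) = det (s H) powi (- int a) \<longleftrightarrow> \<psi> (s H) * det (s H) ^ a = 1" for a
    by (simp add: power_int_minus field_simps)
  hence "chi_exponent \<psi> (s H) =
      (LEAST a. a < group.ord unitary_group (s H) \<and> \<psi> (s H) * det (s H) ^ a = 1)"
    by (simp add: chi_exponent_def)
  also have "\<dots> = (LEAST a. \<psi> (s H) * det (s H) ^ a = 1)"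
  proof (rule Least_equality)
    obtain a where a: "a < group.ord unitary_group (s H)" "\<psi> (s H) * det (s H) ^ a = 1"
      using exponent_exists[OF assms] by blast
    show "(LEAST a. \<psi> (s H) * det (s H) ^ a = 1) < group.ord unitary_group (s H) \<and>
        \<psi> (s H) * det (s H) ^ (LEAST a. \<psi> (s H) * det (s H) ^ a = 1) = 1"
      using a by (auto intro: LeastI le_less_trans[OF Least_le])
  qed (auto intro: Least_le)
  finally show ?thesis using exponent_iff[OF assms] by simp
qed

lemma chi_exponent_cond:
  assumes "H \<in> \<A>"
  shows "\<forall>x\<in>pointwise_stabilizer G H. \<psi> x * det x ^ chi_exponent \<psi> (s H) = 1"
proof -
  obtain a where "\<forall>x\<in>pointwise_stabilizer G H. \<psi> x * det x ^ a = 1"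
    using exponent_exists[OF assms] unfolding exponent_iff[OF assms] by blast
  thus ?thesis unfolding chi_exponent_eq[OF assms] by (rule LeastI)
qed

lemma chi_exponent_least:
  assumes "H \<in> \<A>" "b < chi_exponent \<psi> (s H)"
  shows "\<psi> (s H) * det (s H) ^ b \<noteq> 1"
  using not_less_Least[of b] assms(2) unfolding chi_exponent_eq[OF assms(1)] exponent_iff[OF assms(1)]
  by blast

section \<open>Transport of hyperplanes and exponents by the group\<close>

lemma hyperplane_image:
  assumes "H \<in> \<A>" "g \<in> G"
  shows "(*v) g ` H \<in> \<A>"
proof -
  obtain t where t: "hyperplane H" "t \<in> G" "reflection t" "\<forall>v\<in>H. t *v v = v"
    using assms(1) by (auto simp: reflecting_hyperplanes_def)
  note g = matrix_inv_inverse[OF invertible[OF assms(2)]] matrix_inv_vector[OF invertible[OF assms(2)]]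
  have "inj_on ((*v) g) S" for S by (rule inj_on_inverseI) (rule g(3))
  hence hyp: "hyperplane ((*v) g ` H)"
    using t(1) by (auto simp: hyperplane_def intro!: vec.linear_subspace_image)
      (subst vec.dim_image_eq, auto)
  \<comment> \<open>The conjugate of a reflection in \<open>H\<close> is a reflection in the image
    of \<open>H\<close>; its finite order comes from membership in \<open>G\<close>.\<close>
  let ?t = "g ** t ** matrix_inv g"
  have tG: "?t \<in> G" using assms(2) t(2) by (simp add: mult_closed inv_closed)
  have fixed: "\<forall>v\<in>(*v) g ` H. ?t *v v = v"
    using t(4) by (auto simp: g simp flip: matrix_vector_mul_assoc)
  have "?t \<noteq> mat 1"
  proof
    assume "?t = mat 1"
    hence "matrix_inv g ** ?t ** g = mat 1" by (simp add: g)
    moreover have "matrix_inv g ** ?t ** g = (matrix_inv g ** g) ** t ** (matrix_inv g ** g)"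
      by (simp only: matrix_mul_assoc)
    ultimately show False using t(3) by (simp add: g reflection_def)
  qed
  moreover obtain m where "?t [^]\<^bsub>unitary_group\<^esub> Suc m = mat 1" using finite_order[OF tG] by blast
  ultimately have "reflection ?t"
    unfolding reflection_def using tG hyp fixed unitary by (metis zero_less_Suc)
  thus ?thesis using hyp tG fixed by (auto simp: reflecting_hyperplanes_def)
qed

lemma image_image_inv:
  assumes "g \<in> G"
  shows "(*v) (matrix_inv g) ` ((*v) g ` H) = H" "(*v) g ` ((*v) (matrix_inv g) ` H) = H"
  using matrix_inv_vector[OF invertible[OF assms]] by (auto simp: image_image)

text \<open>Conjugation by \<open>g\<close> relates the two stabilizers and preserves
  \<open>\<psi>\<close> and \<open>det\<close>, so the exponent of \<open>H\<close> also satisfies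
  the condition for the image. The reverse inequality follows by using the inverse of
  \<open>g\<close>.\<close>

lemma chi_exponent_image_le:
  assumes "H \<in> \<A>" "g \<in> G"
  shows "chi_exponent \<psi> (s ((*v) g ` H)) \<le> chi_exponent \<psi> (s H)"
  unfolding chi_exponent_eq[OF hyperplane_image[OF assms]]
proof (rule Least_le, rule ballI)
  fix y assume y: "y \<in> pointwise_stabilizer G ((*v) g ` H)"
  hence yG: "y \<in> G" by (rule stabilizer_group)
  note g = matrix_inv_inverse[OF invertible[OF assms(2)]] matrix_inv_vector[OF invertible[OF assms(2)]]
  let ?x = "matrix_inv g ** y ** g"
  have "?x \<in> pointwise_stabilizer G H"
    using y assms(2)
    by (auto simp: pointwise_stabilizer_def mult_closed inv_closed g simp flip: matrix_vector_mul_assoc)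
  hence "\<psi> ?x * det ?x ^ chi_exponent \<psi> (s H) = 1" using chi_exponent_cond[OF assms(1)] by blast
  moreover have "\<psi> ?x = \<psi> y"
  proof -
    have "\<psi> (matrix_inv g) * \<psi> g = 1"
      using character_mult[of "matrix_inv g" g] assms(2) by (simp add: inv_closed g character_1)
    thus ?thesis using yG assms(2) by (simp add: character_mult mult_closed inv_closed)
  qed
  moreover have "det ?x = det y"
  proof -
    have "det (matrix_inv g) * det g = 1" using g(2) by (metis det_I det_mul)
    thus ?thesis by (simp add: det_mul)
  qed
  ultimately show "\<psi> y * det y ^ chi_exponent \<psi> (s H) = 1" by simp
qed

lemma chi_exponent_image:
  assumes "H \<in> \<A>" "g \<in> G"
  shows "chi_exponent \<psi> (s ((*v) g ` H)) = chi_exponent \<psi> (s H)"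
  using chi_exponent_image_le[OF assms]
    chi_exponent_image_le[OF hyperplane_image[OF assms] inv_closed[OF assms(2)]]
  by (simp add: image_image_inv[OF assms(2)])

end

subsection \<open>The polynomial \<open>Q\<^sub>\<psi>\<close>\<close>

lemma dvd_power_cancel:
  fixes p :: "'a::idom"
  assumes "prime_elem p" "\<not> p dvd x" "p ^ k dvd x * y"
  shows "p ^ k dvd y"
  using assms(3)
proof (induction k arbitrary: y)
  case (Suc k)
  have "p dvd x * y" using Suc.prems by (metis dvd_mult_left power_Suc)
  hence "p dvd y" using assms(1,2) by (simp add: prime_elem_dvd_mult_iff)
  then obtain z where y: "y = p * z" by auto
  have "p * p ^ k dvd p * (x * z)" using Suc.prems by (simp add: y mult_ac)
  hence "p ^ k dvd x * z" using assms(1) by (simp add: prime_elem_def)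
  hence "p ^ k dvd z" by (rule Suc.IH)
  thus ?case by (simp add: y mult_dvd_mono)
qed simp

context reflection_group
begin

text \<open>Each reflecting hyperplane is the entire fixed space of some element of the finite group
  \<open>G\<close>.\<close>

lemma finite_hyperplanes: "finite \<A>"
proof -
  have "H \<in> (\<lambda>g. {v. g *v v = v}) ` G" if H: "H \<in> \<A>" for H
  proof -
    obtain g where g: "g \<in> G" "reflection g" "\<forall>v\<in>H. g *v v = v"
      using H by (auto simp: reflecting_hyperplanes_def)
    obtain w where w: "\<And>v. g *v v = v + dotp (c H) v *s w"
    proof (rule rank_one_if_fixes_kernel)
      show "c H \<noteq> 0" using H by (rule coefficients_nonzero)
      show "g *v v = v" if "dotp (c H) v = 0" for v using that kernel[OF H] g(3) by auto
    qed blast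
    have "w \<noteq> 0"
    proof
      assume "w = 0"
      hence "\<forall>v. g *v v = mat 1 *v v" by (simp add: w)
      hence "g = mat 1" unfolding matrix_eq .
      thus False using g(2) by (simp add: reflection_def)
    qed
    hence "{v. g *v v = v} = {v. dotp (c H) v = 0}" by (auto simp: w vec_eq_iff)
    thus ?thesis using g(1) kernel[OF H] by auto
  qed
  hence "\<A> \<subseteq> (\<lambda>g. {v. g *v v = v}) ` G" by blast
  thus ?thesis using finite_group by (rule finite_subset[OF _ finite_imageI])
qed

lemma prime_form: "H \<in> \<A> \<Longrightarrow> prime_elem (linpol (c H))"
  by (rule prime_elem_linpol) (rule coefficients_nonzero)

lemma proportional_forms:
  assumes "H \<in> \<A>" "\<And>v. v \<in> H \<Longrightarrow> dotp d v = 0"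
  obtains k where "linpol d = pconst k * linpol (c H)"
proof -
  have "dotp d v = 0" if "dotp (c H) v = 0" for v
    using that assms(2) kernel[OF assms(1)] by blast
  then obtain k where "d = k *s c H" by (rule proportional_if_kernel_subset)
  hence "linpol d = pconst k * linpol (c H)" by (simp add: linpol_scale)
  thus ?thesis by (rule that)
qed

text \<open>Divisibility would give an inclusion of kernels, hence proportional nonzero forms and
  equal hyperplanes.\<close>

lemma forms_not_dvd:
  assumes H: "H \<in> \<A>" and H': "H' \<in> \<A>" and "H \<noteq> H'"
  shows "\<not> linpol (c H) dvd linpol (c H')"
proof
  assume "linpol (c H) dvd linpol (c H')"
  then obtain h where h: "linpol (c H') = linpol (c H) * h" by auto
  have "dotp (c H') v = 0" if "dotp (c H) v = 0" for v
    using arg_cong[OF h, of "\<lambda>f. peval f v"] that by (simp add: peval_mult)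
  then obtain k where k: "c H' = k *s c H" by (rule proportional_if_kernel_subset)
  hence dotp: "dotp (c H') v = k * dotp (c H) v" for v
    by (simp add: dotp_def sum_distrib_left mult.assoc)
  have "k \<noteq> 0" using k coefficients_nonzero[OF H'] by auto
  hence "{v. dotp (c H') v = 0} = {v. dotp (c H) v = 0}" by (simp add: dotp)
  thus False using kernel[OF H] kernel[OF H'] assms(3) by simp
qed

text \<open>Restricting the product to a set of hyperplanes allows induction on that set and
  splitting off the factor of one hyperplane.\<close>

definition Q_part :: "'n cvec set set \<Rightarrow> 'n pol" where
  "Q_part B = (\<Prod>H\<in>B. linpol (c H) ^ chi_exponent \<psi> (s H))"

lemma form_not_dvd_Q_part:
  assumes "finite B" "B \<subseteq> \<A>" "H \<in> \<A>" "H \<notin> B"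
  shows "\<not> linpol (c H) dvd Q_part B"
  using assms(1,2,4)
proof (induction B rule: finite_induct)
  case empty
  show ?case using prime_form[OF assms(3)] by (simp add: Q_part_def prime_elem_def)
next
  case (insert H' B)
  have "\<not> linpol (c H) dvd linpol (c H') ^ m" for m
    using forms_not_dvd[OF assms(3), of H'] insert.prems prime_elem_dvd_power[OF prime_form[OF assms(3)]]
    by auto
  thus ?case using insert prime_form[OF assms(3)]
    by (simp add: Q_part_def prime_elem_dvd_mult_iff)
qed

text \<open>The prime of a new hyperplane does not divide the product over the others, so its power
  must divide the cofactor.\<close>

lemma Q_part_dvd:
  assumes "finite B" "B \<subseteq> \<A>" "\<And>H. H \<in> B \<Longrightarrow> linpol (c H) ^ chi_exponent \<psi> (s H) dvd f"
  shows "Q_part B dvd f"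
  using assms
proof (induction B rule: finite_induct)
  case empty
  show ?case by (simp add: Q_part_def)
next
  case (insert H B)
  hence "Q_part B dvd f" by auto
  then obtain h where h: "f = Q_part B * h" by auto
  have "linpol (c H) ^ chi_exponent \<psi> (s H) dvd Q_part B * h"
    using insert.prems(2)[of H] h by simp
  hence "linpol (c H) ^ chi_exponent \<psi> (s H) dvd h"
  proof (rule dvd_power_cancel[rotated 2])
    show "prime_elem (linpol (c H))" using insert.prems(1) by (intro prime_form) simp
    show "\<not> linpol (c H) dvd Q_part B"
      using insert.hyps insert.prems(1) by (intro form_not_dvd_Q_part) simp_all
  qed
  thus ?case using insert.hyps by (simp add: h Q_part_def mult.commute mult_dvd_mono)
qed

section \<open>Semi-invariance of the product of linear forms\<close>

lemma pact_form:
  assumes "H \<in> \<A>" "g \<in> G"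
  shows "\<exists>k. pact g (linpol (c H)) = pconst k * linpol (c ((*v) g ` H))"
proof -
  have "dotp (c H v* matrix_inv g) v = 0" if "v \<in> (*v) g ` H" for v
    using that kernel[OF assms(1)] matrix_inv_vector(1)[OF invertible[OF assms(2)]]
    by (auto simp: dotp_vector_matrix)
  then obtain k where "linpol (c H v* matrix_inv g) = pconst k * linpol (c ((*v) g ` H))"
    by (rule proportional_forms[OF hyperplane_image[OF assms]])
  thus ?thesis unfolding pact_linpol by blast
qed

text \<open>\<open>g\<close> permutes the forms of \<open>B\<close> up to scalars, and exponents are
  constant along orbits, so the product is reproduced up to a scalar.\<close>

lemma pact_Q_part:
  assumes "g \<in> G" and B: "B \<subseteq> \<A>" "bij_betw (\<lambda>H. (*v) g ` H) B B"
  shows "\<exists>k. pact g (Q_part B) = pconst k * Q_part B"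
proof -
  have "\<forall>H\<in>\<A>. \<exists>k. pact g (linpol (c H)) = pconst k * linpol (c ((*v) g ` H))"
    using pact_form assms(1) by blast
  then obtain k where k: "\<forall>H\<in>\<A>. pact g (linpol (c H)) = pconst (k H) * linpol (c ((*v) g ` H))"
    by (rule bchoice[THEN exE])
  let ?e = "\<lambda>H. chi_exponent \<psi> (s H)"
  have "pact g (Q_part B) = (\<Prod>H\<in>B. pconst (k H ^ ?e H) * linpol (c ((*v) g ` H)) ^ ?e ((*v) g ` H))"
    unfolding Q_part_def pact_prod pact_power using B(1) assms(1)
    by (intro prod.cong refl) (auto simp: k power_mult_distrib pconst_power chi_exponent_image)
  also have "\<dots> = (\<Prod>H\<in>B. pconst (k H ^ ?e H)) * Q_part B"
    unfolding prod.distrib Q_part_def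
    using prod.reindex_bij_betw[OF B(2), of "\<lambda>H. linpol (c H) ^ ?e H"] by simp
  also have "(\<Prod>H\<in>B. pconst (k H ^ ?e H)) = pconst (\<Prod>H\<in>B. k H ^ ?e H)"
    by (induction B rule: infinite_finite_induct) (simp_all add: pconst_mult)
  finally show ?thesis by blast
qed

lemma pact_s_Q:
  assumes H: "H \<in> \<A>"
  shows "pact (s H) (Q_part \<A>) = pconst (\<psi> (s H)) * Q_part \<A>"
proof -
  let ?p = "linpol (c H)" and ?e = "chi_exponent \<psi> (s H)" and ?R = "Q_part (\<A> - {H})"
  note sG = s_in_group[OF H]
  have fixed: "s H *v v = v" if "dotp (c H) v = 0" for v using H that by (rule s_fixes)
  have "s H *v v = v" if "v \<in> H" for v using that fixed kernel[OF H] by blast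
  hence image_H: "(*v) (s H) ` H = H" by force
  have "bij_betw (\<lambda>K. (*v) (s H) ` K) (\<A> - {H}) (\<A> - {H})"
  proof (rule bij_betw_byWitness[of _ "\<lambda>K. (*v) (matrix_inv (s H)) ` K"])
    have inv_H: "(*v) (matrix_inv (s H)) ` H = H"
      using image_image_inv(1)[OF sG, of H] unfolding image_H .
    have "(*v) (s H) ` K \<noteq> H" if "K \<noteq> H" for K
      using that image_image_inv(1)[OF sG, of K] inv_H by metis
    thus "(\<lambda>K. (*v) (s H) ` K) ` (\<A> - {H}) \<subseteq> \<A> - {H}"
      using hyperplane_image[OF _ sG] by blast
    have "(*v) (matrix_inv (s H)) ` K \<noteq> H" if "K \<noteq> H" for K
      using that image_image_inv(2)[OF sG, of K] image_H by metis
    thus "(\<lambda>K. (*v) (matrix_inv (s H)) ` K) ` (\<A> - {H}) \<subseteq> \<A> - {H}"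
      using hyperplane_image[OF _ inv_closed[OF sG]] by blast
  qed (simp_all add: image_image_inv[OF sG])
  from pact_Q_part[OF sG _ this] obtain k where k: "pact (s H) ?R = pconst k * ?R" by blast
  \<comment> \<open>\<open>s H\<close> acts trivially modulo \<open>?p\<close>, so the scalar \<open>k\<close> is 1.\<close>
  have "?p dvd pact (s H) ?R - ?R" using invertible[OF sG] fixed by (rule dvd_pact_diff)
  hence "?p dvd pconst (k - 1) * ?R" by (simp add: k pconst_diff algebra_simps)
  moreover have "\<not> ?p dvd ?R"
    using finite_hyperplanes H by (intro form_not_dvd_Q_part) auto
  ultimately have "k = 1" using dvd_pconst_mult_iff[of "k - 1" ?p ?R] by auto
  hence R: "pact (s H) ?R = ?R" using k by simp
  have Q: "Q_part \<A> = ?p ^ ?e * ?R"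
    unfolding Q_part_def using finite_hyperplanes H by (rule prod.remove)
  have "pact (s H) ?p = pconst (1 / det (s H)) * ?p"
    using invertible[OF sG] coefficients_nonzero[OF H] fixed by (rule pact_linpol_fixing_kernel)
  hence "pact (s H) (Q_part \<A>) = pconst ((1 / det (s H)) ^ ?e) * Q_part \<A>"
    unfolding Q by (simp add: pact_mult pact_power R power_mult_distrib pconst_power mult.assoc)
  moreover have "(1 / det (s H)) ^ ?e = \<psi> (s H)"
  proof -
    have "\<psi> (s H) * det (s H) ^ ?e = 1"
      using chi_exponent_cond[OF H] s_in_stabilizer[OF H] by blast
    thus ?thesis using det_nonzero[OF sG] by (simp add: power_one_over field_simps)
  qed
  ultimately show ?thesis by simp
qed

text \<open>The eigenvector equation is multiplicative in \<open>g\<close>. It spreads from each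
  \<open>s H\<close> to the stabilizer of \<open>H\<close>, which contains the reflections fixing
  \<open>H\<close>, and from the reflections to \<open>G\<close>.\<close>

lemma pact_Q:
  assumes "g \<in> G"
  shows "pact g (Q_part \<A>) = pconst (\<psi> g) * Q_part \<A>"
proof -
  let ?P = "\<lambda>g. pact g (Q_part \<A>) = pconst (\<psi> g) * Q_part \<A>"
  have mult: "?P (x ** y)" if "x \<in> G" "y \<in> G" "?P x" "?P y" for x y
  proof -
    have "pact (x ** y) (Q_part \<A>) = pact x (pact y (Q_part \<A>))"
      using that(1,2) by (simp add: pact_pact invertible)
    thus ?thesis using that by (simp add: pact_mult character_mult pconst_mult mult_ac)
  qed
  have one: "?P (mat 1)" by (simp add: character_1)
  have refl: "?P t" if t: "t \<in> {g \<in> G. reflection g}" for t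
  proof -
    obtain H where "hyperplane H" "\<forall>v\<in>H. t *v v = v" using t by (auto simp: reflection_def)
    hence H: "H \<in> \<A>" and "t \<in> pointwise_stabilizer G H"
      using t by (auto simp: reflecting_hyperplanes_def pointwise_stabilizer_def)
    hence "t \<in> generate unitary_group {s H}" using s_generates by simp
    hence "t \<in> G \<and> ?P t"
      by (rule generate_induct[OF _ _ one _ mult]) (use H in \<open>auto simp: s_in_group pact_s_Q\<close>)
    thus ?thesis ..
  qed
  have "g \<in> generate unitary_group {g \<in> G. reflection g}" using assms by (simp add: generated)
  hence "g \<in> G \<and> ?P g" by (rule generate_induct[OF _ _ one refl mult]) auto
  thus ?thesis ..
qed

lemma Q_nonzero: "Q_part \<A> \<noteq> 0"
  using finite_hyperplanes prime_form by (auto simp: Q_part_def prime_elem_def)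

section \<open>Exact division and invariance of the quotient\<close>

lemma Q_dvd_wedge:
  assumes "\<mu> \<in> chi_forms G \<psi>" "\<omega> \<in> chi_forms G \<psi>"
  shows "Q_part \<A> dvd wedge \<mu> \<omega> K"
  using finite_hyperplanes order_refl
proof (rule Q_part_dvd)
  fix H assume H: "H \<in> \<A>"
  note sG = s_in_group[OF H]
  from invertible[OF sG] coefficients_nonzero[OF H] s_fixes[OF H]
  show "linpol (c H) ^ chi_exponent \<psi> (s H) dvd wedge \<mu> \<omega> K"
    by (rule power_dvd_wedge)
      (use assms sG chi_exponent_least[OF H] in \<open>auto simp: chi_forms_iff\<close>)
qed

theorem chi_wedge_chi_forms:
  assumes "\<mu> \<in> chi_forms G \<psi>" "\<omega> \<in> chi_forms G \<psi>"
  shows "fscale (Q_part \<A>) (chi_wedge (Q_part \<A>) \<mu> \<omega>) = wedge \<mu> \<omega>"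
    and "chi_wedge (Q_part \<A>) \<mu> \<omega> \<in> chi_forms G \<psi>"
proof -
  let ?Q = "Q_part \<A>"
  have "\<forall>K. \<exists>f. wedge \<mu> \<omega> K = ?Q * f" using Q_dvd_wedge[OF assms] by (auto simp: dvd_def)
  then obtain \<eta> where "\<And>K. wedge \<mu> \<omega> K = ?Q * \<eta> K" by metis
  hence \<eta>: "fscale ?Q \<eta> = wedge \<mu> \<omega>" by (simp add: fscale_def fun_eq_iff)
  with Q_nonzero have eq: "chi_wedge ?Q \<mu> \<omega> = \<eta>" by (rule chi_wedge_eq)
  show "fscale ?Q (chi_wedge ?Q \<mu> \<omega>) = wedge \<mu> \<omega>" unfolding eq by (rule \<eta>)
  have "form_act g \<eta> = fscale (pconst (\<psi> g)) \<eta>" if g: "g \<in> G" for g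
  proof -
    have "pconst (\<psi> g) \<noteq> (0 :: 'n pol)"
      using character_nonzero[OF g] by (metis peval_pconst peval_0)
    hence nz: "pconst (\<psi> g) * ?Q \<noteq> 0" using Q_nonzero by simp
    \<comment> \<open>The image of \<open>fscale ?Q \<eta>\<close> under \<open>g\<close> is
      computed in two ways: from the factors \<open>?Q\<close> and \<open>\<eta>\<close>, and from
      the wedge product, which picks up the square of \<open>\<psi> g\<close>. Cancelling the
      nonzero factor gives the claim.\<close>
    have "fscale (pconst (\<psi> g) * ?Q) (form_act g \<eta>) = form_act g (fscale ?Q \<eta>)"
      by (simp add: form_act_fscale pact_Q[OF g])
    also have "\<dots> = fscale (pconst (\<psi> g) * pconst (\<psi> g)) (wedge \<mu> \<omega>)"
      using assms g unfolding \<eta>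
      by (simp add: form_act_wedge chi_forms_iff wedge_fscale_left wedge_fscale_right fscale_fscale)
    also have "\<dots> = fscale (pconst (\<psi> g) * ?Q) (fscale (pconst (\<psi> g)) \<eta>)"
      by (simp add: fscale_fscale mult_ac flip: \<eta>)
    finally show ?thesis using nz unfolding fscale_def fun_eq_iff by (metis mult_cancel_left)
  qed
  thus "chi_wedge ?Q \<mu> \<omega> \<in> chi_forms G \<psi>" unfolding eq chi_forms_iff by blast
qed

end

text \<open>The first conjunct says that the division is exact, so that the definite description in
  \<open>chi_wedge\<close> denotes the quotient; the second is the invariance of this
  quotient.\<close>

theorem corollary1:
  fixes G :: "'n::{finite,linorder} cmat set"
    and \<psi> :: "'n cmat \<Rightarrow> complex"
    and \<alpha> :: "'n cvec set \<Rightarrow> 'n pol"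
    and s :: "'n cvec set \<Rightarrow> 'n cmat"
    and \<mu> \<omega> :: "'n form"
  assumes "finite G"
    and "subgroup G unitary_group"
    and "generate unitary_group {g \<in> G. reflection g} = G"
    and "mult_character G \<psi>"
    and "\<And>H. H \<in> reflecting_hyperplanes G \<Longrightarrow>
           linear_form (\<alpha> H) \<and> {v. peval (\<alpha> H) v = 0} = H"
    and "\<And>H. H \<in> reflecting_hyperplanes G \<Longrightarrow>
           s H \<in> pointwise_stabilizer G H \<and>
           generate unitary_group {s H} = pointwise_stabilizer G H"
    and "\<mu> \<in> chi_forms G \<psi>"
    and "\<omega> \<in> chi_forms G \<psi>"
  shows "fscale (Q_chi G \<psi> \<alpha> s) (chi_wedge (Q_chi G \<psi> \<alpha> s) \<mu> \<omega>) = wedge \<mu> \<omega> \<and>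
    chi_wedge (Q_chi G \<psi> \<alpha> s) \<mu> \<omega> \<in> chi_forms G \<psi>"
proof -
  obtain c where c: "\<And>H. H \<in> reflecting_hyperplanes G \<Longrightarrow> \<alpha> H = linpol (c H)"
    using assms(5) unfolding linear_form_iff by metis
  interpret reflection_group G \<psi> c s
  proof (rule reflection_group.intro)
    show "{v. dotp (c H) v = 0} = H" if "H \<in> reflecting_hyperplanes G" for H
      using assms(5)[OF that] by (simp add: c[OF that])
  qed (use assms(1-4,6) in blast)+
  have "Q_chi G \<psi> \<alpha> s = Q_part (reflecting_hyperplanes G)"
    unfolding Q_chi_def Q_part_def by (rule prod.cong) (simp_all add: c)
  thus ?thesis using chi_wedge_chi_forms[OF assms(7,8)] by simp
qed

end
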